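(* Let $(\xi_n,\eta_n)_{n\geq 1}$ be i.i.d. random vectors with values in $\mathbb{R}^2$ (for each $n$ the components $\xi_n$ and $\eta_n$ may be dependent). Let $(S_0,T_0)=(0,0)$ and, for $n\geq 1$, $(S_n,T_n)=\sum_{k=1}^{n}(\xi_k,\eta_k)$. Let $S=(S_n)_{n\geq 0}$ and $T=(T_n)_{n\geq 0}$. Then for every integer $m\geq 1$, \[R\big((S_n)_{0\le n\leq m},(T_n)_{0\le n\leq m}\big)=R(\xi_1,\eta_1)=R(S,T).\]
   Context: For two random elements $X,Y$ (defined on a common probability space, with values in arbitrary measurable spaces), the maximal correlation coefficient is $R(X,Y)=\sup \rho(\varphi(X),\psi(Y))$, where $\rho$ denotes the Pearson correlation coefficient and the supremum is over all real-valued measurable functions $\varphi,\psi$ such that $\varphi(X)$ and $\psi(Y)$ are square-integrable with positive variance. If $X$ or $Y$ is degenerate (i.e. every real measurable function of it is almost surely constant), one sets $R(X,Y)=0$. The sequences $S$ and $T$ are regarded as random elements of $\mathbb{R}^{\{0,1,2,\ldots\}}$ with the product $\sigma$-field. *)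

theory Defs
  imports "HOL-Probability.Probability"
begin

definition covariance :: "'a measure \<Rightarrow> ('a \<Rightarrow> real) \<Rightarrow> ('a \<Rightarrow> real) \<Rightarrow> real" where
  "covariance M U V = (\<integral>\<omega>. (U \<omega> - integral\<^sup>L M U) * (V \<omega> - integral\<^sup>L M V) \<partial>M)"

definition pearson_correlation :: "'a measure \<Rightarrow> ('a \<Rightarrow> real) \<Rightarrow> ('a \<Rightarrow> real) \<Rightarrow> real" where
  "pearson_correlation M U V =
     covariance M U V / sqrt (prob_space.variance M U * prob_space.variance M V)"

text \<open>
  In the following definitions \<open>M\<close> is the underlying probability space, and \<open>X\<close>, \<open>Y\<close> are random
  elements of the measurable spaces \<open>K\<close>, \<open>L\<close> (only the \<open>\<sigma>\<close>-algebras of \<open>K\<close> and \<open>L\<close> matter).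
\<close>

definition degenerate :: "'a measure \<Rightarrow> 'b measure \<Rightarrow> ('a \<Rightarrow> 'b) \<Rightarrow> bool" where
  "degenerate M K X \<longleftrightarrow>
     (\<forall>\<phi> :: 'b \<Rightarrow> real. \<phi> \<in> borel_measurable K \<longrightarrow> (\<exists>c. AE \<omega> in M. \<phi> (X \<omega>) = c))"

definition admissible :: "'a measure \<Rightarrow> 'b measure \<Rightarrow> ('a \<Rightarrow> 'b) \<Rightarrow> ('b \<Rightarrow> real) set" where
  "admissible M K X =
     {\<phi> \<in> borel_measurable K.
        integrable M (\<lambda>\<omega>. (\<phi> (X \<omega>))\<^sup>2) \<and> prob_space.variance M (\<lambda>\<omega>. \<phi> (X \<omega>)) > 0}"

text \<open>
  The supremum is taken in \<open>real\<close>. By Cauchy--Schwarz all the correlations are at most \<open>1\<close>, and if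
  neither \<open>X\<close> nor \<open>Y\<close> is degenerate there are (bounded) admissible functions for both, so it is a
  supremum of a nonempty bounded set.
\<close>

definition maximal_correlation ::
    "'a measure \<Rightarrow> 'b measure \<Rightarrow> ('a \<Rightarrow> 'b) \<Rightarrow> 'c measure \<Rightarrow> ('a \<Rightarrow> 'c) \<Rightarrow> real" where
  "maximal_correlation M K X L Y =
     (if degenerate M K X \<or> degenerate M L Y then 0
      else Sup {pearson_correlation M (\<lambda>\<omega>. \<phi> (X \<omega>)) (\<lambda>\<omega>. \<psi> (Y \<omega>)) | \<phi> \<psi>.
                  \<phi> \<in> admissible M K X \<and> \<psi> \<in> admissible M L Y})"

text \<open>The value \<open>\<xi> 0\<close> is never used; the steps of the walk are \<open>\<xi> 1, \<xi> 2, \<dots>\<close>.\<close>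

definition partial_sum :: "(nat \<Rightarrow> 'a \<Rightarrow> real) \<Rightarrow> nat \<Rightarrow> 'a \<Rightarrow> real" where
  "partial_sum \<xi> n \<omega> = (\<Sum>k=1..n. \<xi> k \<omega>)"

text \<open>
  The family \<open>(S\<^sub>n)\<close>, \<open>n \<in> I\<close>, as a random element of the space of functions on \<open>I\<close> with the product
  \<open>\<sigma>\<close>-algebra \<open>path_space I\<close>; elements of a product space over \<open>I\<close> have to be \<open>undefined\<close> outside
  \<open>I\<close>, hence the restriction.
\<close>

abbreviation path_space :: "nat set \<Rightarrow> (nat \<Rightarrow> real) measure" where
  "path_space I \<equiv> Pi\<^sub>M I (\<lambda>_. borel)"

definition walk :: "nat set \<Rightarrow> (nat \<Rightarrow> 'a \<Rightarrow> real) \<Rightarrow> 'a \<Rightarrow> nat \<Rightarrow> real" where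
  "walk I \<xi> \<omega> = (\<lambda>n\<in>I. partial_sum \<xi> n \<omega>)"

end

(* The number r \<ge> 0 bounds the maximal correlation iff cov(\<phi>(X), \<psi>(Y)) \<le> r sqrt(var \<phi>(X) var \<psi>(Y)) for all
   square-integrable \<phi>(X), \<psi>(Y); this form also covers degenerate X, Y, and it passes to functions of X and of Y.
   It tensorizes: if (X1, Y1) and (X2, Y2) are independent and r works for both, then by the law of total
   covariance cov(f(X1, X2), g(Y1, Y2)) is the covariance of the conditional means given (X1, Y1) plus the mean of
   the conditional covariances.  The first is controlled by r for (X1, Y1), the second by r for (X2, Y2) and
   Cauchy-Schwarz, and sqrt(a b) + sqrt(c d) \<le> sqrt((a + c)(b + d)) recombines them.  Induction over the steps
   gives the finite walks.  For the infinite walk, cylinder functions are dense in L2, and both sides of the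
   inequality are continuous in L2.  Conversely, the first step is a function of the walk. *)

theory Submission
  imports Defs
begin

section \<open>Square-integrable functions\<close>

text \<open>Tensorization works because independence of the two pairs makes the mean of f(X1, X2)
  given (X1, Y1) a function of X1 alone, and that of g(Y1, Y2) a function of Y1 alone, so the bound
  for the first pair applies to these means. Once (X1, Y1) is frozen, f and g become functions of X2
  and of Y2, so the bound for the second pair applies to the conditional covariance. The constant
  does not deteriorate: the same r comes out, hence it holds for walks of every length, and this
  uniformity is what the infinite walk relies on. The obstacle there is that a function of the whole
  path need not depend on finitely many coordinates; approximation is done for S and T separately,
  so that each approximant is still a function of one path. Equality of two maximal correlations
  then follows from equality of the sets of nonnegative r bounding them, each value being
  nonnegative.\<close>

definition sq_integrable :: "'a measure \<Rightarrow> ('a \<Rightarrow> real) \<Rightarrow> bool" where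
  "sq_integrable M f \<longleftrightarrow> f \<in> borel_measurable M \<and> integrable M (\<lambda>x. (f x)\<^sup>2)"

lemma sq_integrable_measurable [measurable_dest]: "sq_integrable M f \<Longrightarrow> f \<in> borel_measurable M"
  and sq_integrable_square: "sq_integrable M f \<Longrightarrow> integrable M (\<lambda>x. (f x)\<^sup>2)"
  by (auto simp: sq_integrable_def)

lemma integrable_mult_sq_integrable:
  assumes "sq_integrable M f" "sq_integrable M g"
  shows "integrable M (\<lambda>x. f x * g x)"
proof (rule Bochner_Integration.integrable_bound)
  show "integrable M (\<lambda>x. (f x)\<^sup>2 + (g x)\<^sup>2)"
    using assms by (simp add: sq_integrable_square)
  show "(\<lambda>x. f x * g x) \<in> borel_measurable M"
    using assms by measurable
  have "\<bar>f x * g x\<bar> \<le> (f x)\<^sup>2 + (g x)\<^sup>2" for x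
    using sum_squares_bound[of "\<bar>f x\<bar>" "\<bar>g x\<bar>"] abs_ge_zero[of "f x * g x"]
    unfolding abs_mult power2_abs by linarith
  then show "AE x in M. norm (f x * g x) \<le> norm ((f x)\<^sup>2 + (g x)\<^sup>2)"
    by simp
qed

lemma sq_integrable_add:
  assumes "sq_integrable M f" "sq_integrable M g"
  shows "sq_integrable M (\<lambda>x. f x + g x)"
  unfolding sq_integrable_def
proof
  show "(\<lambda>x. f x + g x) \<in> borel_measurable M"
    using assms by (intro borel_measurable_add sq_integrable_measurable)
  have "integrable M (\<lambda>x. (f x)\<^sup>2 + (g x)\<^sup>2 + 2 * (f x * g x))"
    by (intro Bochner_Integration.integrable_add integrable_mult_right sq_integrable_square assms
        integrable_mult_sq_integrable)
  then show "integrable M (\<lambda>x. (f x + g x)\<^sup>2)"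
    by (simp only: power2_sum mult.assoc)
qed

lemma sq_integrable_cmult: "sq_integrable M f \<Longrightarrow> sq_integrable M (\<lambda>x. c * f x)"
  by (auto simp: sq_integrable_def power_mult_distrib)

lemma sq_integrable_diff:
  assumes "sq_integrable M f" "sq_integrable M g"
  shows "sq_integrable M (\<lambda>x. f x - g x)"
  using sq_integrable_add[OF assms(1) sq_integrable_cmult[OF assms(2), of "-1"]] by simp

lemma sq_integrable_bound:
  assumes "sq_integrable M g" "f \<in> borel_measurable M" "AE x in M. \<bar>f x\<bar> \<le> \<bar>g x\<bar>"
  shows "sq_integrable M f"
  unfolding sq_integrable_def
proof
  show "integrable M (\<lambda>x. (f x)\<^sup>2)"
  proof (rule Bochner_Integration.integrable_bound[OF sq_integrable_square[OF assms(1)]])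
    show "AE x in M. norm ((f x)\<^sup>2) \<le> norm ((g x)\<^sup>2)"
      using assms(3) by (simp add: abs_le_square_iff)
  qed (use assms(2) in measurable)
qed (rule assms)

lemma (in finite_measure) sq_integrable_const: "sq_integrable M (\<lambda>_. c)"
  by (simp add: sq_integrable_def)

lemma (in finite_measure) sq_integrable_imp_integrable: "sq_integrable M f \<Longrightarrow> integrable M f"
  unfolding sq_integrable_def by (elim conjE) (rule square_integrable_imp_integrable)

text \<open>The bound is proved for the integral of |f g|, where the version for nonnegative
  integrals applies to |f| and |g|; all values are finite and can be read back in the reals.\<close>

lemma Cauchy_Schwarz_integral:
  assumes f: "sq_integrable M f" and g: "sq_integrable M g"
  shows "\<bar>\<integral>x. f x * g x \<partial>M\<bar> \<le> sqrt (\<integral>x. (f x)\<^sup>2 \<partial>M) * sqrt (\<integral>x. (g x)\<^sup>2 \<partial>M)"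
proof -
  note [measurable] = sq_integrable_measurable[OF f] sq_integrable_measurable[OF g]
  let ?I = "\<integral>x. \<bar>f x * g x\<bar> \<partial>M"
  have int: "integrable M (\<lambda>x. \<bar>f x * g x\<bar>)"
    using integrable_mult_sq_integrable[OF f g] by simp
  have "(ennreal ?I)\<^sup>2 = (\<integral>\<^sup>+x. ennreal \<bar>f x\<bar> * ennreal \<bar>g x\<bar> \<partial>M)\<^sup>2"
    by (subst nn_integral_eq_integral[OF int, symmetric]) (auto simp: abs_mult ennreal_mult)
  also have "\<dots> \<le> (\<integral>\<^sup>+x. (ennreal \<bar>f x\<bar>)\<^sup>2 \<partial>M) * (\<integral>\<^sup>+x. (ennreal \<bar>g x\<bar>)\<^sup>2 \<partial>M)"
    by (rule Cauchy_Schwarz_nn_integral) auto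
  also have "\<dots> = ennreal ((\<integral>x. (f x)\<^sup>2 \<partial>M) * (\<integral>x. (g x)\<^sup>2 \<partial>M))"
    using sq_integrable_square[OF f] sq_integrable_square[OF g]
    by (simp add: ennreal_power nn_integral_eq_integral ennreal_mult)
  finally have "?I\<^sup>2 \<le> (\<integral>x. (f x)\<^sup>2 \<partial>M) * (\<integral>x. (g x)\<^sup>2 \<partial>M)"
    by (simp add: ennreal_power)
  then have "?I \<le> sqrt (\<integral>x. (f x)\<^sup>2 \<partial>M) * sqrt (\<integral>x. (g x)\<^sup>2 \<partial>M)"
    unfolding real_sqrt_mult[symmetric] by (rule real_le_rsqrt)
  moreover have "\<bar>\<integral>x. f x * g x \<partial>M\<bar> \<le> ?I"
    by (rule integral_abs_bound)
  ultimately show ?thesis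
    by (rule order_trans[rotated])
qed

section \<open>Covariance and variance of square-integrable random variables\<close>

context prob_space
begin

lemma covariance_eq:
  assumes "sq_integrable M U" "sq_integrable M V"
  shows "covariance M U V = expectation (\<lambda>x. U x * V x) - expectation U * expectation V"
proof -
  note [simp] = integrable_mult_sq_integrable[OF assms] assms[THEN sq_integrable_imp_integrable]
  have "covariance M U V
      = expectation (\<lambda>x. U x * V x - expectation U * V x - expectation V * U x + expectation U * expectation V)"
    unfolding covariance_def by (intro Bochner_Integration.integral_cong refl) (simp add: algebra_simps)
  then show ?thesis
    by (simp add: prob_space)
qed

lemma covariance_self_eq:
  assumes "sq_integrable M U"
  shows "covariance M U U = expectation (\<lambda>x. (U x)\<^sup>2) - (expectation U)\<^sup>2"
  using covariance_eq[OF assms assms] by (simp add: power2_eq_square)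

lemma covariance_self: "covariance M U U = variance U"
  by (simp add: covariance_def power2_eq_square)

lemma covariance_self_nonneg: "0 \<le> covariance M U U"
  unfolding covariance_self by (rule variance_positive)

lemma covariance_Cauchy_Schwarz:
  assumes "sq_integrable M U" "sq_integrable M V"
  shows "\<bar>covariance M U V\<bar> \<le> sqrt (covariance M U U * covariance M V V)"
  unfolding covariance_def real_sqrt_mult power2_eq_square[symmetric]
  by (intro Cauchy_Schwarz_integral sq_integrable_diff sq_integrable_const assms)

end

section \<open>The covariance inequality with constant r\<close>

text \<open>The correlation bound with its denominator cleared. It is one-sided, but replacing
  \<open>\<phi>\<close> by its negative changes the sign of the left side only, so the absolute
  covariance obeys the same bound.\<close>

definition covariance_bounded ::
    "real \<Rightarrow> 'a measure \<Rightarrow> 'b measure \<Rightarrow> ('a \<Rightarrow> 'b) \<Rightarrow> 'c measure \<Rightarrow> ('a \<Rightarrow> 'c) \<Rightarrow> bool" where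
  "covariance_bounded r M K X L Y \<longleftrightarrow>
     (\<forall>\<phi> \<in> borel_measurable K. \<forall>\<psi> \<in> borel_measurable L.
        sq_integrable M (\<lambda>\<omega>. \<phi> (X \<omega>)) \<longrightarrow> sq_integrable M (\<lambda>\<omega>. \<psi> (Y \<omega>)) \<longrightarrow>
        covariance M (\<lambda>\<omega>. \<phi> (X \<omega>)) (\<lambda>\<omega>. \<psi> (Y \<omega>))
          \<le> r * sqrt (covariance M (\<lambda>\<omega>. \<phi> (X \<omega>)) (\<lambda>\<omega>. \<phi> (X \<omega>))
                    * covariance M (\<lambda>\<omega>. \<psi> (Y \<omega>)) (\<lambda>\<omega>. \<psi> (Y \<omega>))))"

lemma covariance_boundedD:
  assumes "covariance_bounded r M K X L Y"
    and "\<phi> \<in> borel_measurable K" "\<psi> \<in> borel_measurable L"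
    and "sq_integrable M (\<lambda>\<omega>. \<phi> (X \<omega>))" "sq_integrable M (\<lambda>\<omega>. \<psi> (Y \<omega>))"
  shows "covariance M (\<lambda>\<omega>. \<phi> (X \<omega>)) (\<lambda>\<omega>. \<psi> (Y \<omega>))
     \<le> r * sqrt (covariance M (\<lambda>\<omega>. \<phi> (X \<omega>)) (\<lambda>\<omega>. \<phi> (X \<omega>))
               * covariance M (\<lambda>\<omega>. \<psi> (Y \<omega>)) (\<lambda>\<omega>. \<psi> (Y \<omega>)))"
  using assms by (simp add: covariance_bounded_def)

lemma covariance_bounded_compose:
  assumes b: "covariance_bounded r M K X L Y"
    and h: "h \<in> measurable K K'" and k: "k \<in> measurable L L'"
  shows "covariance_bounded r M K' (\<lambda>\<omega>. h (X \<omega>)) L' (\<lambda>\<omega>. k (Y \<omega>))"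
  unfolding covariance_bounded_def
proof (intro ballI impI)
  fix \<phi> :: "'d \<Rightarrow> real" and \<psi> :: "'e \<Rightarrow> real"
  assume [measurable]: "\<phi> \<in> borel_measurable K'" "\<psi> \<in> borel_measurable L'"
    and sq: "sq_integrable M (\<lambda>\<omega>. \<phi> (h (X \<omega>)))" "sq_integrable M (\<lambda>\<omega>. \<psi> (k (Y \<omega>)))"
  note [measurable] = h k
  show "covariance M (\<lambda>\<omega>. \<phi> (h (X \<omega>))) (\<lambda>\<omega>. \<psi> (k (Y \<omega>)))
     \<le> r * sqrt (covariance M (\<lambda>\<omega>. \<phi> (h (X \<omega>))) (\<lambda>\<omega>. \<phi> (h (X \<omega>)))
               * covariance M (\<lambda>\<omega>. \<psi> (k (Y \<omega>))) (\<lambda>\<omega>. \<psi> (k (Y \<omega>))))"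
    by (rule covariance_boundedD[OF b, of "\<lambda>x. \<phi> (h x)" "\<lambda>x. \<psi> (k x)", OF _ _ sq])
      measurable
qed

text \<open>Only the joint law of \<open>X\<close> and \<open>Y\<close> enters the inequality. This
  allows the underlying probability space to be changed, both for independent blocks and for
  identically distributed pairs.\<close>

lemma covariance_bounded_distr:
  assumes [measurable]: "X \<in> measurable M K" "Y \<in> measurable M L"
  shows "covariance_bounded r (distr M (K \<Otimes>\<^sub>M L) (\<lambda>\<omega>. (X \<omega>, Y \<omega>))) K fst L snd
     \<longleftrightarrow> covariance_bounded r M K X L Y"
proof -
  have sq: "sq_integrable (distr M (K \<Otimes>\<^sub>M L) (\<lambda>\<omega>. (X \<omega>, Y \<omega>))) F
      \<longleftrightarrow> sq_integrable M (\<lambda>\<omega>. F (X \<omega>, Y \<omega>))" if [measurable]: "F \<in> borel_measurable (K \<Otimes>\<^sub>M L)" for F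
    by (auto simp: sq_integrable_def integrable_distr_eq)
  have cov: "covariance (distr M (K \<Otimes>\<^sub>M L) (\<lambda>\<omega>. (X \<omega>, Y \<omega>))) F G
      = covariance M (\<lambda>\<omega>. F (X \<omega>, Y \<omega>)) (\<lambda>\<omega>. G (X \<omega>, Y \<omega>))"
    if [measurable]: "F \<in> borel_measurable (K \<Otimes>\<^sub>M L)" "G \<in> borel_measurable (K \<Otimes>\<^sub>M L)" for F G
    by (simp add: covariance_def integral_distr)
  show ?thesis
    unfolding covariance_bounded_def
  proof (intro ball_cong refl, goal_cases)
    case (1 \<phi> \<psi>)
    note [measurable] = 1
    have 3: "(\<lambda>\<omega>. \<phi> (fst \<omega>)) \<in> borel_measurable (K \<Otimes>\<^sub>M L)"
      and 2: "(\<lambda>\<omega>. \<psi> (snd \<omega>)) \<in> borel_measurable (K \<Otimes>\<^sub>M L)"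
      by measurable
    show ?case
      unfolding sq[OF 3] sq[OF 2] cov[OF 3 2] cov[OF 3 3] cov[OF 2 2] fst_conv snd_conv ..
  qed
qed

text \<open>Cauchy-Schwarz in the plane for (sqrt a, sqrt c) and (sqrt b, sqrt d). The first root is
  left unsplit because \<open>a * b\<close> comes from the bound on the covariance of means,
  \<open>sqrt c * sqrt d\<close> from Cauchy-Schwarz for integrals.\<close>

lemma mult_add_sqrt_le:
  fixes a b c d :: real
  assumes "a \<ge> 0" "b \<ge> 0" "c \<ge> 0" "d \<ge> 0"
  shows "sqrt (a * b) + sqrt c * sqrt d \<le> sqrt ((a + c) * (b + d))"
proof (rule real_le_rsqrt)
  have "2 * (sqrt (a * d) * sqrt (b * c)) \<le> a * d + b * c"
    using sum_squares_bound[of "sqrt (a * d)" "sqrt (b * c)"] assms by simp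
  then show "(sqrt (a * b) + sqrt c * sqrt d)\<^sup>2 \<le> (a + c) * (b + d)"
    using assms by (simp add: power2_sum power_mult_distrib algebra_simps real_sqrt_mult)
qed

section \<open>Characterization of the maximal correlation\<close>

context prob_space
begin

lemma admissible_iff:
  assumes "X \<in> measurable M K"
  shows "\<phi> \<in> admissible M K X \<longleftrightarrow> \<phi> \<in> borel_measurable K \<and> sq_integrable M (\<lambda>\<omega>. \<phi> (X \<omega>)) \<and>
           covariance M (\<lambda>\<omega>. \<phi> (X \<omega>)) (\<lambda>\<omega>. \<phi> (X \<omega>)) > 0"
  using measurable_compose[OF assms, of \<phi> borel]
  by (auto simp: admissible_def sq_integrable_def covariance_self)

lemma covariance_self_AE_const:
  assumes "U \<in> borel_measurable M" "AE \<omega> in M. U \<omega> = c"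
  shows "covariance M U U = 0"
proof -
  have "expectation U = c"
    using integral_cong_AE[of U M "\<lambda>_. c"] assms by (simp add: prob_space)
  then have "AE \<omega> in M. (U \<omega> - expectation U) * (U \<omega> - expectation U) = 0"
    using assms(2) by auto
  then show ?thesis
    unfolding covariance_def by (rule integral_eq_zero_AE)
qed

lemma covariance_self_zero_imp_AE_const:
  assumes U: "sq_integrable M U" and "covariance M U U = 0"
  shows "AE \<omega> in M. U \<omega> = expectation U"
proof -
  have "integrable M (\<lambda>\<omega>. (U \<omega> - expectation U)\<^sup>2)"
    by (intro sq_integrable_square sq_integrable_diff U sq_integrable_const)
  then have "AE \<omega> in M. (U \<omega> - expectation U)\<^sup>2 = 0"
    using assms(2) by (subst (asm) covariance_self) (simp add: integral_nonneg_eq_0_iff_AE)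
  then show ?thesis by simp
qed

text \<open>Nondegeneracy only yields a measurable function that is not almost surely constant and
  may fail to be square-integrable. Composing it with arctan makes it bounded, and injectivity of
  arctan keeps it nonconstant.\<close>

lemma admissible_nonempty:
  assumes X: "X \<in> measurable M K" and "\<not> degenerate M K X"
  obtains \<phi> where "\<phi> \<in> admissible M K X"
proof -
  obtain \<phi> :: "'b \<Rightarrow> real" where [measurable]: "\<phi> \<in> borel_measurable K"
    and nc: "\<And>c. \<not> (AE \<omega> in M. \<phi> (X \<omega>) = c)"
    using assms by (auto simp: degenerate_def)
  let ?\<psi> = "\<lambda>x. arctan (\<phi> x)"
  note [measurable] = X
  have meas: "?\<psi> \<in> borel_measurable K"
    by measurable
  have sq: "sq_integrable M (\<lambda>\<omega>. ?\<psi> (X \<omega>))"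
  proof (rule sq_integrable_bound[OF sq_integrable_const[of "pi / 2"]])
    show "(\<lambda>\<omega>. ?\<psi> (X \<omega>)) \<in> borel_measurable M"
      by measurable
    show "AE \<omega> in M. \<bar>?\<psi> (X \<omega>)\<bar> \<le> \<bar>pi / 2\<bar>"
    proof (rule AE_I2)
      show "\<bar>?\<psi> (X \<omega>)\<bar> \<le> \<bar>pi / 2\<bar>" for \<omega>
        using arctan_bounded[of "\<phi> (X \<omega>)"] by linarith
    qed
  qed
  have "covariance M (\<lambda>\<omega>. ?\<psi> (X \<omega>)) (\<lambda>\<omega>. ?\<psi> (X \<omega>)) \<noteq> 0"
  proof
    assume "covariance M (\<lambda>\<omega>. ?\<psi> (X \<omega>)) (\<lambda>\<omega>. ?\<psi> (X \<omega>)) = 0"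
    from covariance_self_zero_imp_AE_const[OF sq this]
    have "AE \<omega> in M. \<phi> (X \<omega>) = tan (expectation (\<lambda>\<omega>. ?\<psi> (X \<omega>)))"
      by eventually_elim (metis tan_arctan)
    with nc show False by blast
  qed
  with covariance_self_nonneg have "covariance M (\<lambda>\<omega>. ?\<psi> (X \<omega>)) (\<lambda>\<omega>. ?\<psi> (X \<omega>)) > 0"
    by (metis order_le_less)
  with meas sq have "?\<psi> \<in> admissible M K X"
    by (simp add: admissible_iff[OF X])
  then show ?thesis
    by (rule that)
qed

lemma admissible_empty:
  assumes X: "X \<in> measurable M K" and "degenerate M K X"
  shows "admissible M K X = {}"
proof (rule equals0I)
  fix \<phi> assume ad: "\<phi> \<in> admissible M K X"
  with assms obtain c where "AE \<omega> in M. \<phi> (X \<omega>) = c"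
    by (auto simp: degenerate_def admissible_iff)
  with ad show False
    using covariance_self_AE_const[of "\<lambda>\<omega>. \<phi> (X \<omega>)" c] sq_integrable_measurable
    by (auto simp: admissible_iff[OF X])
qed

lemma pearson_correlation_le_one:
  assumes "sq_integrable M U" "sq_integrable M V"
    and "covariance M U U > 0" "covariance M V V > 0"
  shows "\<bar>pearson_correlation M U V\<bar> \<le> 1"
proof -
  have "0 < sqrt (covariance M U U * covariance M V V)"
    using assms by simp
  then show ?thesis
    using covariance_Cauchy_Schwarz[OF assms(1,2)]
    unfolding pearson_correlation_def covariance_self[symmetric] abs_divide
    by (simp add: divide_le_eq_1)
qed

lemma covariance_uminus_left: "covariance M (\<lambda>\<omega>. - U \<omega>) V = - covariance M U V"
proof -
  have "covariance M (\<lambda>\<omega>. - U \<omega>) V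
      = expectation (\<lambda>\<omega>. - ((U \<omega> - expectation U) * (V \<omega> - expectation V)))"
    unfolding covariance_def by (intro Bochner_Integration.integral_cong) (auto simp: algebra_simps)
  then show ?thesis by (simp add: covariance_def)
qed

lemma covariance_self_uminus: "covariance M (\<lambda>\<omega>. - U \<omega>) (\<lambda>\<omega>. - U \<omega>) = covariance M U U"
  unfolding covariance_def by (intro Bochner_Integration.integral_cong) (auto simp: algebra_simps)

context
  fixes K :: "'b measure" and L :: "'c measure" and X Y
  assumes X: "X \<in> measurable M K" and Y: "Y \<in> measurable M L"
begin

lemma pearson_correlation_le_maximal_correlation:
  assumes "\<not> degenerate M K X" "\<not> degenerate M L Y"
    and "\<phi> \<in> admissible M K X" "\<psi> \<in> admissible M L Y"
  shows "pearson_correlation M (\<lambda>\<omega>. \<phi> (X \<omega>)) (\<lambda>\<omega>. \<psi> (Y \<omega>)) \<le> maximal_correlation M K X L Y"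
proof -
  have "bdd_above {pearson_correlation M (\<lambda>\<omega>. \<phi> (X \<omega>)) (\<lambda>\<omega>. \<psi> (Y \<omega>)) | \<phi> \<psi>.
                  \<phi> \<in> admissible M K X \<and> \<psi> \<in> admissible M L Y}"
    using pearson_correlation_le_one
    by (intro bdd_aboveI[of _ 1]) (fastforce simp: admissible_iff X Y abs_le_iff)
  with assms show ?thesis
    unfolding maximal_correlation_def by (auto intro!: cSup_upper)
qed

text \<open>The supremum lies above the correlations of both (phi, psi) and (-phi, psi), which are
  opposite numbers. Nonnegativity lets the value itself serve as \<open>r\<close> in the criterion
  below.\<close>

lemma maximal_correlation_nonneg: "0 \<le> maximal_correlation M K X L Y"
proof (cases "degenerate M K X \<or> degenerate M L Y")
  case False
  then obtain \<phi> \<psi> where ad: "\<phi> \<in> admissible M K X" "\<psi> \<in> admissible M L Y"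
    using admissible_nonempty X Y by metis
  have neg: "(\<lambda>x. - \<phi> x) \<in> admissible M K X"
    using ad(1) unfolding admissible_iff[OF X] covariance_self_uminus
    by (auto simp: sq_integrable_def)
  have "pearson_correlation M (\<lambda>\<omega>. - \<phi> (X \<omega>)) (\<lambda>\<omega>. \<psi> (Y \<omega>))
      = - pearson_correlation M (\<lambda>\<omega>. \<phi> (X \<omega>)) (\<lambda>\<omega>. \<psi> (Y \<omega>))"
    unfolding pearson_correlation_def covariance_self[symmetric] covariance_self_uminus
      covariance_uminus_left by simp
  with pearson_correlation_le_maximal_correlation[OF _ _ ad]
    pearson_correlation_le_maximal_correlation[OF _ _ neg ad(2)] False
  show ?thesis by simp
qed (simp add: maximal_correlation_def)

lemma covariance_boundedI_admissible:
  assumes "r \<ge> 0"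
    and "\<And>\<phi> \<psi>. \<phi> \<in> admissible M K X \<Longrightarrow> \<psi> \<in> admissible M L Y \<Longrightarrow>
           pearson_correlation M (\<lambda>\<omega>. \<phi> (X \<omega>)) (\<lambda>\<omega>. \<psi> (Y \<omega>)) \<le> r"
  shows "covariance_bounded r M K X L Y"
  unfolding covariance_bounded_def
proof (intro ballI impI)
  fix \<phi> \<psi>
  assume m: "\<phi> \<in> borel_measurable K" "\<psi> \<in> borel_measurable L"
    and sq: "sq_integrable M (\<lambda>\<omega>. \<phi> (X \<omega>))" "sq_integrable M (\<lambda>\<omega>. \<psi> (Y \<omega>))"
  let ?U = "\<lambda>\<omega>. \<phi> (X \<omega>)" and ?V = "\<lambda>\<omega>. \<psi> (Y \<omega>)"
  let ?D = "covariance M ?U ?U * covariance M ?V ?V"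
  show "covariance M ?U ?V \<le> r * sqrt ?D"
  proof (cases "?D = 0")
    \<comment> \<open>Such a pair is not admissible, but by Cauchy-Schwarz its covariance is at most
      0.\<close>
    case True
    then show ?thesis
      using covariance_Cauchy_Schwarz[OF sq] unfolding True by simp
  next
    case False
    then have pos: "covariance M ?U ?U > 0" "covariance M ?V ?V > 0"
      using covariance_self_nonneg[of ?U] covariance_self_nonneg[of ?V] by auto
    then have "covariance M ?U ?V / sqrt ?D \<le> r"
      using assms(2)[of \<phi> \<psi>] m sq
      by (simp add: admissible_iff X Y pearson_correlation_def covariance_self)
    moreover have "sqrt ?D > 0"
      using pos by simp
    ultimately show ?thesis
      by (simp only: pos_divide_le_eq)
  qed
qed

lemma pearson_correlation_le_if_covariance_bounded:
  assumes "covariance_bounded r M K X L Y" "\<phi> \<in> admissible M K X" "\<psi> \<in> admissible M L Y"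
  shows "pearson_correlation M (\<lambda>\<omega>. \<phi> (X \<omega>)) (\<lambda>\<omega>. \<psi> (Y \<omega>)) \<le> r"
proof -
  have "sqrt (covariance M (\<lambda>\<omega>. \<phi> (X \<omega>)) (\<lambda>\<omega>. \<phi> (X \<omega>)) * covariance M (\<lambda>\<omega>. \<psi> (Y \<omega>)) (\<lambda>\<omega>. \<psi> (Y \<omega>))) > 0"
    using assms(2,3) by (simp add: admissible_iff X Y)
  then show ?thesis
    using covariance_boundedD[OF assms(1), of \<phi> \<psi>] assms(2,3)
    unfolding pearson_correlation_def covariance_self[symmetric]
    by (simp add: admissible_iff X Y pos_divide_le_eq)
qed

text \<open>For nondegenerate variables this is the least-upper-bound property. In the degenerate
  case both sides hold: the left one because the value is 0 by convention and r \<ge> 0, the right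
  one because no pair is admissible.\<close>

lemma maximal_correlation_le_iff:
  assumes "r \<ge> 0"
  shows "maximal_correlation M K X L Y \<le> r \<longleftrightarrow> covariance_bounded r M K X L Y"
proof (cases "degenerate M K X \<or> degenerate M L Y")
  case True
  have "admissible M K X = {} \<or> admissible M L Y = {}"
    using True admissible_empty X Y by metis
  then have "covariance_bounded r M K X L Y"
    by (intro covariance_boundedI_admissible assms) auto
  with True assms show ?thesis
    by (simp add: maximal_correlation_def)
next
  case False
  then obtain \<phi> \<psi> where ad: "\<phi> \<in> admissible M K X" "\<psi> \<in> admissible M L Y"
    using admissible_nonempty X Y by metis
  show ?thesis
  proof
    assume "maximal_correlation M K X L Y \<le> r"
    then show "covariance_bounded r M K X L Y"
      using False pearson_correlation_le_maximal_correlation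
      by (intro covariance_boundedI_admissible assms) (meson order_trans)
  next
    assume "covariance_bounded r M K X L Y"
    with ad show "maximal_correlation M K X L Y \<le> r"
      unfolding maximal_correlation_def if_not_P[OF False]
      by (intro cSup_least) (auto intro: pearson_correlation_le_if_covariance_bounded)
  qed
qed

end

end

text \<open>Two nonnegative numbers with the same nonnegative upper bounds agree, as one sees by
  taking \<open>r\<close> to be each of them in turn.\<close>

lemma maximal_correlation_eqI:
  assumes "prob_space M"
    and "X \<in> measurable M K" "Y \<in> measurable M L" "X' \<in> measurable M K'" "Y' \<in> measurable M L'"
    and "\<And>r. r \<ge> 0 \<Longrightarrow> covariance_bounded r M K X L Y \<longleftrightarrow> covariance_bounded r M K' X' L' Y'"
  shows "maximal_correlation M K X L Y = maximal_correlation M K' X' L' Y'"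
proof -
  interpret prob_space M by fact
  note nn = maximal_correlation_nonneg[OF assms(2,3)] maximal_correlation_nonneg[OF assms(4,5)]
  note iff = maximal_correlation_le_iff[OF assms(2,3)] maximal_correlation_le_iff[OF assms(4,5)]
  show ?thesis
    by (intro order.antisym) (use nn iff assms(6) in blast)+
qed

section \<open>Independent pairs\<close>

text \<open>In the lemmas on sections the ambient \<open>M\<close> is the second factor, and the
  coordinate \<open>a\<close> of the first is frozen. Fubini gives square-integrability of sections
  only outside a null set, so later statements on single sections are almost-everywhere
  statements.\<close>

lemma (in prob_space) AE_sq_integrable_section:
  assumes N: "prob_space N" and U: "sq_integrable (N \<Otimes>\<^sub>M M) (\<lambda>(a, b). U a b)"
  shows "AE a in N. sq_integrable M (U a)"
proof -
  interpret N: prob_space N by fact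
  interpret P: pair_prob_space N M ..
  have "AE a in N. integrable M (\<lambda>b. (U a b)\<^sup>2)"
    using P.AE_integrable_fst[of "\<lambda>a b. (U a b)\<^sup>2"] sq_integrable_square[OF U]
    by (simp add: split_beta')
  with AE_space show ?thesis
  proof eventually_elim
    fix a assume "a \<in> space N" "integrable M (\<lambda>b. (U a b)\<^sup>2)"
    moreover have "U a \<in> borel_measurable M"
      using measurable_Pair2[OF sq_integrable_measurable[OF U] \<open>a \<in> space N\<close>] by simp
    ultimately show "sq_integrable M (U a)"
      by (simp add: sq_integrable_def)
  qed
qed

lemma (in prob_space) expectation_square_le:
  assumes "sq_integrable M U"
  shows "(expectation U)\<^sup>2 \<le> expectation (\<lambda>x. (U x)\<^sup>2)"
  using covariance_self_nonneg[of U] covariance_self_eq[OF assms] by simp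

text \<open>The square of a section mean is at most the mean of the square, and by Fubini the latter
  is integrable in \<open>a\<close>.\<close>

lemma (in prob_space) sq_integrable_section_mean:
  assumes N: "prob_space N" and U: "sq_integrable (N \<Otimes>\<^sub>M M) (\<lambda>(a, b). U a b)"
  shows "sq_integrable N (\<lambda>a. expectation (U a))"
proof -
  interpret N: prob_space N by fact
  interpret P: pair_prob_space N M ..
  note [measurable] = sq_integrable_measurable[OF U]
  show ?thesis
    unfolding sq_integrable_def
  proof
    show "(\<lambda>a. expectation (U a)) \<in> borel_measurable N"
      by measurable
    show "integrable N (\<lambda>a. (expectation (U a))\<^sup>2)"
    proof (rule Bochner_Integration.integrable_bound)
      show "integrable N (\<lambda>a. expectation (\<lambda>b. (U a b)\<^sup>2))"
        using P.integrable_fst[of "\<lambda>a b. (U a b)\<^sup>2"] sq_integrable_square[OF U]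
        by (simp add: split_beta')
      show "AE a in N. norm ((expectation (U a))\<^sup>2) \<le> norm (expectation (\<lambda>b. (U a b)\<^sup>2))"
        using AE_sq_integrable_section[OF N U]
      proof eventually_elim
        case (elim a)
        show ?case using expectation_square_le[OF elim] by simp
      qed
    qed measurable
  qed
qed

text \<open>Integrating E(U_a V_a) - E U_a E V_a over \<open>a\<close> gives, by Fubini, E(U V)
  minus the mean of the product of section means. That product reappears with opposite sign in the
  covariance of the section means, which leaves E(U V) - E U E V.\<close>

lemma (in prob_space) law_of_total_covariance:
  assumes N: "prob_space N"
    and U: "sq_integrable (N \<Otimes>\<^sub>M M) (\<lambda>(a, b). U a b)" and V: "sq_integrable (N \<Otimes>\<^sub>M M) (\<lambda>(a, b). V a b)"
  shows "integrable N (\<lambda>a. covariance M (U a) (V a))"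
    and "covariance (N \<Otimes>\<^sub>M M) (\<lambda>(a, b). U a b) (\<lambda>(a, b). V a b)
       = covariance N (\<lambda>a. expectation (U a)) (\<lambda>a. expectation (V a))
         + (\<integral>a. covariance M (U a) (V a) \<partial>N)"
proof -
  interpret N: prob_space N by fact
  interpret P: pair_prob_space N M ..
  let ?EU = "\<lambda>a. expectation (U a)" and ?EV = "\<lambda>a. expectation (V a)"
  note [measurable] = sq_integrable_measurable[OF U] sq_integrable_measurable[OF V]
  note mean = sq_integrable_section_mean[OF N U] sq_integrable_section_mean[OF N V]
  have intUV: "integrable (N \<Otimes>\<^sub>M M) (\<lambda>(a, b). U a b * V a b)"
    using integrable_mult_sq_integrable[OF U V] by (simp add: split_beta')
  have int1: "integrable N (\<lambda>a. expectation (\<lambda>b. U a b * V a b))"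
    by (rule P.integrable_fst[OF intUV])
  have int2: "integrable N (\<lambda>a. ?EU a * ?EV a)"
    by (rule integrable_mult_sq_integrable[OF mean])
  have cov: "AE a in N. expectation (\<lambda>b. U a b * V a b) - ?EU a * ?EV a = covariance M (U a) (V a)"
    using AE_sq_integrable_section[OF N U] AE_sq_integrable_section[OF N V]
    by eventually_elim (simp add: covariance_eq)
  have meas: "(\<lambda>a. covariance M (U a) (V a)) \<in> borel_measurable N"
    unfolding covariance_def by measurable
  have int3: "integrable N (\<lambda>a. expectation (\<lambda>b. U a b * V a b) - ?EU a * ?EV a)"
    by (intro Bochner_Integration.integrable_diff int1 int2)
  show "integrable N (\<lambda>a. covariance M (U a) (V a))"
    using int3 integrable_cong_AE[OF borel_measurable_integrable[OF int3] meas cov] by blast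
  have "(\<integral>a. covariance M (U a) (V a) \<partial>N)
      = (\<integral>a. expectation (\<lambda>b. U a b * V a b) \<partial>N) - (\<integral>a. ?EU a * ?EV a \<partial>N)"
    using integral_cong_AE[OF borel_measurable_integrable[OF int3] meas cov]
      Bochner_Integration.integral_diff[OF int1 int2] by simp
  moreover have "(\<integral>a. expectation (\<lambda>b. U a b * V a b) \<partial>N)
      = (\<integral>x. (case x of (a, b) \<Rightarrow> U a b) * (case x of (a, b) \<Rightarrow> V a b) \<partial>(N \<Otimes>\<^sub>M M))"
    using P.integral_fst[OF intUV] by (simp add: split_beta')
  moreover have "(\<integral>a. ?EU a \<partial>N) = integral\<^sup>L (N \<Otimes>\<^sub>M M) (\<lambda>(a, b). U a b)"
    "(\<integral>a. ?EV a \<partial>N) = integral\<^sup>L (N \<Otimes>\<^sub>M M) (\<lambda>(a, b). V a b)"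
    using P.integral_fst[OF P.P.sq_integrable_imp_integrable[OF U]]
      P.integral_fst[OF P.P.sq_integrable_imp_integrable[OF V]] by simp_all
  ultimately show "covariance (N \<Otimes>\<^sub>M M) (\<lambda>(a, b). U a b) (\<lambda>(a, b). V a b)
       = covariance N ?EU ?EV + (\<integral>a. covariance M (U a) (V a) \<partial>N)"
    unfolding P.P.covariance_eq[OF U V] N.covariance_eq[OF mean] by simp
qed

lemma covariance_bounded_pair_measure:
  assumes "prob_space M" "prob_space N" and "r \<ge> 0"
    and X1[measurable]: "X1 \<in> measurable M K1" and Y1[measurable]: "Y1 \<in> measurable M L1"
    and X2[measurable]: "X2 \<in> measurable N K2" and Y2[measurable]: "Y2 \<in> measurable N L2"
    and b1: "covariance_bounded r M K1 X1 L1 Y1" and b2: "covariance_bounded r N K2 X2 L2 Y2"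
  shows "covariance_bounded r (M \<Otimes>\<^sub>M N) (K1 \<Otimes>\<^sub>M K2) (\<lambda>(a, b). (X1 a, X2 b))
           (L1 \<Otimes>\<^sub>M L2) (\<lambda>(a, b). (Y1 a, Y2 b))"
  unfolding covariance_bounded_def
proof (intro ballI impI)
  fix \<phi> :: "_ \<Rightarrow> real" and \<psi> :: "_ \<Rightarrow> real"
  assume [measurable]: "\<phi> \<in> borel_measurable (K1 \<Otimes>\<^sub>M K2)" "\<psi> \<in> borel_measurable (L1 \<Otimes>\<^sub>M L2)"
  assume sq: "sq_integrable (M \<Otimes>\<^sub>M N) (\<lambda>\<omega>. \<phi> (case \<omega> of (a, b) \<Rightarrow> (X1 a, X2 b)))"
    "sq_integrable (M \<Otimes>\<^sub>M N) (\<lambda>\<omega>. \<psi> (case \<omega> of (a, b) \<Rightarrow> (Y1 a, Y2 b)))"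
  interpret M: prob_space M by fact
  interpret N: prob_space N by fact
  let ?U = "\<lambda>a b. \<phi> (X1 a, X2 b)" and ?V = "\<lambda>a b. \<psi> (Y1 a, Y2 b)"
  let ?U' = "\<lambda>a. N.expectation (?U a)" and ?V' = "\<lambda>a. N.expectation (?V a)"
  let ?cU = "\<lambda>a. covariance N (?U a) (?U a)" and ?cV = "\<lambda>a. covariance N (?V a) (?V a)"
  have eq: "(\<lambda>\<omega>. \<phi> (case \<omega> of (a, b) \<Rightarrow> (X1 a, X2 b))) = (\<lambda>(a, b). ?U a b)"
    "(\<lambda>\<omega>. \<psi> (case \<omega> of (a, b) \<Rightarrow> (Y1 a, Y2 b))) = (\<lambda>(a, b). ?V a b)"
    by auto
  have U: "sq_integrable (M \<Otimes>\<^sub>M N) (\<lambda>(a, b). ?U a b)" and V: "sq_integrable (M \<Otimes>\<^sub>M N) (\<lambda>(a, b). ?V a b)"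
    using sq unfolding eq by simp_all
  note total = N.law_of_total_covariance[OF \<open>prob_space M\<close>]
  note mean = N.sq_integrable_section_mean[OF \<open>prob_space M\<close>]
  \<comment> \<open>Integrable conditional variances are square-integrable conditional standard
    deviations, the form in which Cauchy-Schwarz over \<open>a\<close> is applied.\<close>
  have root: "sq_integrable M (\<lambda>a. sqrt (?cU a))" "sq_integrable M (\<lambda>a. sqrt (?cV a))"
    using total(1)[OF U U] total(1)[OF V V]
    by (auto simp: sq_integrable_def N.covariance_self_nonneg)
  \<comment> \<open>The section means depend on \<open>a\<close> only through \<open>X1 a\<close>
    and \<open>Y1 a\<close>; this form exhibits the functions to which \<open>b1\<close> is
    applied.\<close>
  have meanU: "sq_integrable M (\<lambda>a. (\<lambda>x. N.expectation (\<lambda>b. \<phi> (x, X2 b))) (X1 a))"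
    and meanV: "sq_integrable M (\<lambda>a. (\<lambda>y. N.expectation (\<lambda>b. \<psi> (y, Y2 b))) (Y1 a))"
    using mean[OF U] mean[OF V] by simp_all
  have section_bound: "AE a in M. covariance N (?U a) (?V a) \<le> r * (sqrt (?cU a) * sqrt (?cV a))"
    using N.AE_sq_integrable_section[OF \<open>prob_space M\<close> U]
      N.AE_sq_integrable_section[OF \<open>prob_space M\<close> V] AE_space
  proof eventually_elim
    case (elim a)
    \<comment> \<open>Sections of \<open>\<phi>\<close> and \<open>\<psi>\<close> are measurable at
      points of the spaces of \<open>K1\<close> and \<open>L1\<close>, which is why \<open>a\<close>
      is taken in the space of \<open>M\<close>.\<close>
    have [measurable]: "X1 a \<in> space K1" "Y1 a \<in> space L1"
      using measurable_space[OF X1] measurable_space[OF Y1] elim by auto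
    show ?case
      unfolding real_sqrt_mult[symmetric]
      by (rule covariance_boundedD[OF b2, of "\<lambda>x. \<phi> (X1 a, x)" "\<lambda>y. \<psi> (Y1 a, y)", OF _ _ elim(1,2)])
        measurable
  qed
  have "(\<integral>a. covariance N (?U a) (?V a) \<partial>M) \<le> (\<integral>a. r * (sqrt (?cU a) * sqrt (?cV a)) \<partial>M)"
    by (intro integral_mono_AE total(1)[OF U V] integrable_mult_right
        integrable_mult_sq_integrable root section_bound)
  also have "\<dots> \<le> r * (sqrt (\<integral>a. ?cU a \<partial>M) * sqrt (\<integral>a. ?cV a \<partial>M))"
    using Cauchy_Schwarz_integral[OF root] \<open>r \<ge> 0\<close>
    by (auto intro!: mult_left_mono simp: N.covariance_self_nonneg abs_le_iff)
  finally have inner: "(\<integral>a. covariance N (?U a) (?V a) \<partial>M)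
      \<le> r * (sqrt (\<integral>a. ?cU a \<partial>M) * sqrt (\<integral>a. ?cV a \<partial>M))" .
  have outer: "covariance M ?U' ?V' \<le> r * sqrt (covariance M ?U' ?U' * covariance M ?V' ?V')"
    by (rule covariance_boundedD[OF b1, of "\<lambda>x. N.expectation (\<lambda>b. \<phi> (x, X2 b))"
          "\<lambda>y. N.expectation (\<lambda>b. \<psi> (y, Y2 b))", OF _ _ meanU meanV]) measurable
  have "covariance (M \<Otimes>\<^sub>M N) (\<lambda>(a, b). ?U a b) (\<lambda>(a, b). ?V a b)
      \<le> r * (sqrt (covariance M ?U' ?U' * covariance M ?V' ?V')
            + sqrt (\<integral>a. ?cU a \<partial>M) * sqrt (\<integral>a. ?cV a \<partial>M))"
    using inner outer by (simp add: total(2)[OF U V] distrib_left)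
  also have "\<dots> \<le> r * sqrt ((covariance M ?U' ?U' + (\<integral>a. ?cU a \<partial>M))
                            * (covariance M ?V' ?V' + (\<integral>a. ?cV a \<partial>M)))"
    using \<open>r \<ge> 0\<close>
    by (intro mult_left_mono mult_add_sqrt_le M.covariance_self_nonneg Bochner_Integration.integral_nonneg
        N.covariance_self_nonneg)
  finally show "covariance (M \<Otimes>\<^sub>M N) (\<lambda>\<omega>. \<phi> (case \<omega> of (a, b) \<Rightarrow> (X1 a, X2 b)))
        (\<lambda>\<omega>. \<psi> (case \<omega> of (a, b) \<Rightarrow> (Y1 a, Y2 b)))
     \<le> r * sqrt (covariance (M \<Otimes>\<^sub>M N) (\<lambda>\<omega>. \<phi> (case \<omega> of (a, b) \<Rightarrow> (X1 a, X2 b)))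
                    (\<lambda>\<omega>. \<phi> (case \<omega> of (a, b) \<Rightarrow> (X1 a, X2 b)))
                * covariance (M \<Otimes>\<^sub>M N) (\<lambda>\<omega>. \<psi> (case \<omega> of (a, b) \<Rightarrow> (Y1 a, Y2 b)))
                    (\<lambda>\<omega>. \<psi> (case \<omega> of (a, b) \<Rightarrow> (Y1 a, Y2 b))))"
    unfolding eq total(2)[OF U U] total(2)[OF V V] .
qed

(* indep_var forces Z and W to have the same type, so the four variables of interest enter as functions of them. *)
lemma (in prob_space) covariance_bounded_indep_var:
  assumes "r \<ge> 0" and ind: "indep_var A Z B W"
    and x1[measurable]: "x1 \<in> measurable A K1" and y1[measurable]: "y1 \<in> measurable A L1"
    and x2[measurable]: "x2 \<in> measurable B K2" and y2[measurable]: "y2 \<in> measurable B L2"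
    and b1: "covariance_bounded r M K1 (\<lambda>\<omega>. x1 (Z \<omega>)) L1 (\<lambda>\<omega>. y1 (Z \<omega>))"
    and b2: "covariance_bounded r M K2 (\<lambda>\<omega>. x2 (W \<omega>)) L2 (\<lambda>\<omega>. y2 (W \<omega>))"
  shows "covariance_bounded r M (K1 \<Otimes>\<^sub>M K2) (\<lambda>\<omega>. (x1 (Z \<omega>), x2 (W \<omega>)))
           (L1 \<Otimes>\<^sub>M L2) (\<lambda>\<omega>. (y1 (Z \<omega>), y2 (W \<omega>)))"
proof -
  have Z[measurable]: "Z \<in> measurable M A" and W[measurable]: "W \<in> measurable M B"
    using ind by (auto dest: indep_var_rv1 indep_var_rv2)
  interpret D: prob_space "distr M B W"
    by (rule prob_space_distr) measurable
  \<comment> \<open>\<open>S\<close> regroups the independent blocks \<open>z\<close> and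
    \<open>w\<close> into the X-side and the Y-side.\<close>
  define S where "S = (\<lambda>(z, w). ((x1 z, x2 w), (y1 z, y2 w)))"
  let ?T = "(K1 \<Otimes>\<^sub>M K2) \<Otimes>\<^sub>M (L1 \<Otimes>\<^sub>M L2)"
  have [measurable]: "S \<in> measurable (A \<Otimes>\<^sub>M B) ?T"
    unfolding S_def by measurable
  \<comment> \<open>By independence (Z, W) has the law of (Z a, W b) with a and b drawn
    independently from \<open>M\<close>, which moves the problem to the product space
    \<open>M \<Otimes>\<^sub>M M\<close>.\<close>
  have "distr M (A \<Otimes>\<^sub>M B) (\<lambda>\<omega>. (Z \<omega>, W \<omega>))
      = distr (M \<Otimes>\<^sub>M M) (A \<Otimes>\<^sub>M B) (\<lambda>(a, b). (Z a, W b))"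
    using ind pair_measure_distr[OF Z W D.sigma_finite_measure_axioms]
    unfolding indep_var_distribution_eq by simp
  from arg_cong[where f = "\<lambda>D. distr D ?T S", OF this]
  have law: "distr M ?T (\<lambda>\<omega>. ((x1 (Z \<omega>), x2 (W \<omega>)), (y1 (Z \<omega>), y2 (W \<omega>))))
      = distr (M \<Otimes>\<^sub>M M) ?T (\<lambda>\<omega>. (case \<omega> of (a, b) \<Rightarrow> (x1 (Z a), x2 (W b)),
                                  case \<omega> of (a, b) \<Rightarrow> (y1 (Z a), y2 (W b))))"
    by (simp add: distr_distr comp_def S_def split_beta')
  have "covariance_bounded r (M \<Otimes>\<^sub>M M) (K1 \<Otimes>\<^sub>M K2) (\<lambda>(a, b). (x1 (Z a), x2 (W b)))
           (L1 \<Otimes>\<^sub>M L2) (\<lambda>(a, b). (y1 (Z a), y2 (W b)))"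
    by (intro covariance_bounded_pair_measure assms prob_space_axioms) measurable
  then show ?thesis
    using covariance_bounded_distr[of "\<lambda>(a, b). (x1 (Z a), x2 (W b))" "M \<Otimes>\<^sub>M M" "K1 \<Otimes>\<^sub>M K2"
        "\<lambda>(a, b). (y1 (Z a), y2 (W b))" "L1 \<Otimes>\<^sub>M L2" r]
      covariance_bounded_distr[of "\<lambda>\<omega>. (x1 (Z \<omega>), x2 (W \<omega>))" M "K1 \<Otimes>\<^sub>M K2"
        "\<lambda>\<omega>. (y1 (Z \<omega>), y2 (W \<omega>))" "L1 \<Otimes>\<^sub>M L2" r]
    by (simp add: law)
qed

section \<open>Density of cylinder functions\<close>

text \<open>The closure of \<open>C\<close> for the L2 seminorm, formed with functions instead of
  classes modulo null sets; the distance is kept squared.\<close>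

definition L2_closure :: "'a measure \<Rightarrow> ('a \<Rightarrow> real) set \<Rightarrow> ('a \<Rightarrow> real) set" where
  "L2_closure M C = {f. sq_integrable M f \<and> (\<forall>e>0. \<exists>h\<in>C. (\<integral>x. (f x - h x)\<^sup>2 \<partial>M) < e)}"

text \<open>Stands in for the triangle inequality: (u + v)^2 \<le> 2 u^2 + 2 v^2 allows squared
  distances to be combined without roots.\<close>

lemma integral_square_lincomb_le:
  fixes f g :: "'a \<Rightarrow> real"
  assumes f: "sq_integrable M f" and g: "sq_integrable M g"
  shows "(\<integral>x. (a * f x + g x)\<^sup>2 \<partial>M) \<le> 2 * a\<^sup>2 * (\<integral>x. (f x)\<^sup>2 \<partial>M) + 2 * (\<integral>x. (g x)\<^sup>2 \<partial>M)"
proof -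
  have "(\<integral>x. (a * f x + g x)\<^sup>2 \<partial>M) \<le> (\<integral>x. 2 * a\<^sup>2 * (f x)\<^sup>2 + 2 * (g x)\<^sup>2 \<partial>M)"
  proof (rule integral_mono)
    show "integrable M (\<lambda>x. (a * f x + g x)\<^sup>2)"
      by (intro sq_integrable_square sq_integrable_add sq_integrable_cmult f g)
    show "integrable M (\<lambda>x. 2 * a\<^sup>2 * (f x)\<^sup>2 + 2 * (g x)\<^sup>2)"
      by (intro Bochner_Integration.integrable_add integrable_mult_right sq_integrable_square f g)
    show "(a * f x + g x)\<^sup>2 \<le> 2 * a\<^sup>2 * (f x)\<^sup>2 + 2 * (g x)\<^sup>2" for x
      using sum_squares_bound[of "a * f x" "g x"] by (simp add: power2_sum power_mult_distrib)
  qed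
  also have "\<dots> = 2 * a\<^sup>2 * (\<integral>x. (f x)\<^sup>2 \<partial>M) + 2 * (\<integral>x. (g x)\<^sup>2 \<partial>M)"
    using f g by (simp add: sq_integrable_square)
  finally show ?thesis .
qed

lemma L2_closure_lincomb:
  assumes C: "\<And>h. h \<in> C \<Longrightarrow> sq_integrable M h"
    "\<And>a h k. h \<in> C \<Longrightarrow> k \<in> C \<Longrightarrow> (\<lambda>x. a * h x + k x) \<in> C"
    and f: "f \<in> L2_closure M C" and g: "g \<in> L2_closure M C"
  shows "(\<lambda>x. a * f x + g x) \<in> L2_closure M C"
  unfolding L2_closure_def mem_Collect_eq
proof (intro conjI allI impI)
  have sq: "sq_integrable M f" "sq_integrable M g"
    using f g by (auto simp: L2_closure_def)
  then show "sq_integrable M (\<lambda>x. a * f x + g x)"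
    by (intro sq_integrable_add sq_integrable_cmult)
  fix e :: real assume "e > 0"
  \<comment> \<open>The final error is (2 a^2 + 2) times the error allowed for \<open>f\<close> and
    for \<open>g\<close>.\<close>
  define c where "c = e / (2 * a\<^sup>2 + 2)"
  have "2 * a\<^sup>2 + 2 > 0"
    by (simp add: add_nonneg_pos)
  then have "c > 0" and c: "c * (2 * a\<^sup>2 + 2) = e"
    using \<open>e > 0\<close> by (simp_all add: c_def)
  obtain h k where h: "h \<in> C" "(\<integral>x. (f x - h x)\<^sup>2 \<partial>M) < c" and k: "k \<in> C" "(\<integral>x. (g x - k x)\<^sup>2 \<partial>M) < c"
    using f g \<open>c > 0\<close> unfolding L2_closure_def by blast
  have "(\<integral>x. (a * f x + g x - (a * h x + k x))\<^sup>2 \<partial>M) = (\<integral>x. (a * (f x - h x) + (g x - k x))\<^sup>2 \<partial>M)"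
    by (simp add: algebra_simps)
  also have "\<dots> \<le> 2 * a\<^sup>2 * (\<integral>x. (f x - h x)\<^sup>2 \<partial>M) + 2 * (\<integral>x. (g x - k x)\<^sup>2 \<partial>M)"
    by (intro integral_square_lincomb_le sq_integrable_diff sq C h k)
  also have "\<dots> < 2 * a\<^sup>2 * c + 2 * c"
    using h(2) k(2) by (intro add_le_less_mono mult_left_mono) auto
  also have "\<dots> = e"
    using c by (simp add: algebra_simps)
  finally show "\<exists>h\<in>C. (\<integral>x. (a * f x + g x - h x)\<^sup>2 \<partial>M) < e"
    by (intro bexI[of _ "\<lambda>x. a * h x + k x"] C(2) h(1) k(1))
qed

text \<open>Dominated convergence brings some \<open>s n\<close> close to \<open>f\<close>, and that
  \<open>s n\<close> is then approximated from \<open>C\<close>.\<close>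

lemma L2_closure_dominated:
  assumes C: "\<And>h. h \<in> C \<Longrightarrow> sq_integrable M h"
    and s: "\<And>n. s n \<in> L2_closure M C" and f: "sq_integrable M f"
    and lim: "\<And>x. x \<in> space M \<Longrightarrow> (\<lambda>n. s n x) \<longlonglongrightarrow> f x"
    and bound: "\<And>n x. x \<in> space M \<Longrightarrow> \<bar>s n x\<bar> \<le> 2 * \<bar>f x\<bar>"
  shows "f \<in> L2_closure M C"
  unfolding L2_closure_def mem_Collect_eq
proof (intro conjI allI impI f)
  fix e :: real assume "e > 0"
  have sq: "sq_integrable M (s n)" for n
    using s by (auto simp: L2_closure_def)
  note [measurable] = sq_integrable_measurable[OF f] sq_integrable_measurable[OF sq]
  have "(\<lambda>n. \<integral>x. (f x - s n x)\<^sup>2 \<partial>M) \<longlonglongrightarrow> (\<integral>x. 0 \<partial>M)"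
  \<comment> \<open>From |s n| \<le> 2 |f| the difference is at most 3 |f|, hence the 9.\<close>
  proof (rule integral_dominated_convergence[where w = "\<lambda>x. 9 * (f x)\<^sup>2"])
    show "integrable M (\<lambda>x. 9 * (f x)\<^sup>2)"
      by (intro integrable_mult_right sq_integrable_square f)
    show "AE x in M. (\<lambda>n. (f x - s n x)\<^sup>2) \<longlonglongrightarrow> 0"
    proof (rule AE_I2)
      fix x assume "x \<in> space M"
      from tendsto_power[OF tendsto_diff[OF tendsto_const[of "f x"] lim[OF this]], of 2]
      show "(\<lambda>n. (f x - s n x)\<^sup>2) \<longlonglongrightarrow> 0" by simp
    qed
    show "AE x in M. norm ((f x - s n x)\<^sup>2) \<le> 9 * (f x)\<^sup>2" for n
    proof (rule AE_I2)
      fix x assume "x \<in> space M"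
      from bound[OF this, of n] have "\<bar>f x - s n x\<bar> \<le> \<bar>3 * f x\<bar>" by linarith
      then show "norm ((f x - s n x)\<^sup>2) \<le> 9 * (f x)\<^sup>2"
        by (simp add: abs_le_square_iff power_mult_distrib)
    qed
  qed measurable
  then have "(\<lambda>n. \<integral>x. (f x - s n x)\<^sup>2 \<partial>M) \<longlonglongrightarrow> 0" by simp
  \<comment> \<open>Both errors are doubled below, and 2 (e / 4) + 2 (e / 4) = e.\<close>
  from order_tendstoD(2)[OF this, of "e / 4"] \<open>e > 0\<close>
  obtain n where n: "(\<integral>x. (f x - s n x)\<^sup>2 \<partial>M) < e / 4"
    by (auto simp: eventually_sequentially)
  obtain h where h: "h \<in> C" "(\<integral>x. (s n x - h x)\<^sup>2 \<partial>M) < e / 4"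
    using s[of n] \<open>e > 0\<close> unfolding L2_closure_def by (auto dest!: spec[of _ "e / 4"])
  have "(\<integral>x. (1 * (f x - s n x) + (s n x - h x))\<^sup>2 \<partial>M)
      \<le> 2 * 1\<^sup>2 * (\<integral>x. (f x - s n x)\<^sup>2 \<partial>M) + 2 * (\<integral>x. (s n x - h x)\<^sup>2 \<partial>M)"
    by (intro integral_square_lincomb_le sq_integrable_diff sq f C h)
  then have "(\<integral>x. (f x - h x)\<^sup>2 \<partial>M) < e"
    using n h(2) by simp
  with h(1) show "\<exists>h\<in>C. (\<integral>x. (f x - h x)\<^sup>2 \<partial>M) < e" by blast
qed

lemma L2_closure_cong:
  assumes "f \<in> L2_closure M C" "\<And>x. x \<in> space M \<Longrightarrow> f x = g x"
  shows "g \<in> L2_closure M C"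
proof -
  have "sq_integrable M f \<longleftrightarrow> sq_integrable M g"
    unfolding sq_integrable_def
    using assms(2) by (intro conj_cong measurable_cong Bochner_Integration.integrable_cong) auto
  moreover have "(\<integral>x. (f x - h x)\<^sup>2 \<partial>M) = (\<integral>x. (g x - h x)\<^sup>2 \<partial>M)" for h
    using assms(2) by (intro Bochner_Integration.integral_cong) auto
  ultimately show ?thesis
    using assms(1) by (simp add: L2_closure_def)
qed

text \<open>A pi-lambda argument: the measurable sets whose indicators lie in the closure form a
  Dynkin system containing the intersection-stable generator, hence all of \<open>sets M\<close>.
  Linear combinations give the simple functions, and dominated limits give all square-integrable
  functions.\<close>

lemma (in finite_measure) L2_closure_generator:
  assumes G: "Int_stable G" "G \<subseteq> Pow (space M)" "sets M = sigma_sets (space M) G"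
    and sq: "\<And>h. h \<in> C \<Longrightarrow> sq_integrable M h"
    and lin: "\<And>a h k. h \<in> C \<Longrightarrow> k \<in> C \<Longrightarrow> (\<lambda>x. a * h x + k x) \<in> C"
    and one: "(\<lambda>_. 1) \<in> C"
    and ind: "\<And>A. A \<in> G \<Longrightarrow> indicator A \<in> C"
    and f: "sq_integrable M f"
  shows "f \<in> L2_closure M C"
proof -
  have C: "C \<subseteq> L2_closure M C"
    using sq unfolding L2_closure_def by (force intro!: bexI)
  have comb: "(\<lambda>x. a * g x + k x) \<in> L2_closure M C"
    if "g \<in> L2_closure M C" "k \<in> L2_closure M C" for a g k
    using sq lin that by (rule L2_closure_lincomb)
  have one': "(\<lambda>_. 1) \<in> L2_closure M C"
    using C one by blast
  have zero: "(\<lambda>_. 0) \<in> L2_closure M C"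
    using comb[OF one' one', of "-1"] by simp
  have sum: "(\<lambda>x. \<Sum>i\<in>I. c i * g i x) \<in> L2_closure M C"
    if "finite I" "\<And>i. i \<in> I \<Longrightarrow> g i \<in> L2_closure M C" for I and c :: "'i \<Rightarrow> real" and g
    using that by (induction I rule: finite_induct) (auto intro: comb zero)
  have indicator_sq: "sq_integrable M (indicator A)" if "A \<in> sets M" for A
    using that by (intro sq_integrable_bound[OF sq_integrable_const[of 1]]) (auto split: split_indicator)
  have indicator: "indicator A \<in> L2_closure M C" if "A \<in> sets M" for A
    using G(1,2) that[unfolded G(3)]
  proof (induction A rule: sigma_sets_induct_disjoint)
    case (basic A)
    then show ?case using ind C by blast
  next
    case empty
    then show ?case using zero by (simp add: indicator_def)
  next
    case (compl A)
    show ?case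
      \<comment> \<open>The indicator of the complement is \<open>1 - indicator A\<close>, but only
        on \<open>space M\<close>, hence the congruence.\<close>
      by (rule L2_closure_cong[OF comb[OF compl(2) one', of "-1"]]) (simp split: split_indicator)
  next
    case (union A)
    have meas: "A i \<in> sets M" for i
      using union(2) G(3) by auto
    show ?case
    proof (rule L2_closure_dominated[OF sq])
      show "(\<lambda>x. \<Sum>i<n. 1 * indicator (A i) x) \<in> L2_closure M C" for n
        using union by (intro sum) auto
      \<comment> \<open>Disjointness turns the partial sums into indicators of finite unions, which
        increase to the indicator of the whole union and stay below it.\<close>
      have eq: "(\<Sum>i<n. 1 * indicator (A i) x) = (indicator (\<Union>i<n. A i) x :: real)" for n x
        using union(1) by (subst indicator_UN_disjoint) (auto simp: disjoint_family_on_def)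
      show "sq_integrable M (indicator (\<Union>(range A)))"
        using meas by (intro indicator_sq) auto
      show "(\<lambda>n. \<Sum>i<n. 1 * indicator (A i) x) \<longlonglongrightarrow> (indicator (\<Union>(range A)) x :: real)" for x
        unfolding eq by (rule LIMSEQ_indicator_UN)
      show "\<bar>\<Sum>i<n. 1 * indicator (A i) x\<bar> \<le> 2 * \<bar>indicator (\<Union>(range A)) x :: real\<bar>" for n x
        unfolding eq by (auto split: split_indicator)
    qed
  qed
  \<comment> \<open>With base point 0 the approximation theorem bounds distances from 0, which is
    where the factor 2 in \<open>L2_closure_dominated\<close> comes from.\<close>
  obtain s where s: "\<And>i. simple_function M (s i)" "\<And>x. x \<in> space M \<Longrightarrow> (\<lambda>i. s i x) \<longlonglongrightarrow> f x"
    "\<And>i x. x \<in> space M \<Longrightarrow> \<bar>s i x\<bar> \<le> 2 * \<bar>f x\<bar>"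
    using borel_measurable_implies_sequence_metric[OF sq_integrable_measurable[OF f], of 0]
    unfolding dist_real_def diff_0_right by metis
  have "s n \<in> L2_closure M C" for n
  proof (rule L2_closure_cong)
    show "(\<lambda>x. \<Sum>y\<in>s n ` space M. y * indicator (s n -` {y} \<inter> space M) x) \<in> L2_closure M C"
      by (rule sum) (rule simple_functionD[OF s(1)] indicator)+
    show "(\<Sum>y\<in>s n ` space M. y * indicator (s n -` {y} \<inter> space M) x) = s n x" if "x \<in> space M" for x
      using simple_function_indicator_representation_banach[OF s(1)[of n] that, symmetric]
      by (simp add: mult.commute)
  qed
  from L2_closure_dominated[where C = C, OF _ this f s(2,3)] sq show ?thesis
    by blast
qed

section \<open>Continuity of the covariance in L2\<close>

text \<open>Expanded around the limit, the error is a sum of products in which every factor is a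
  difference or a fixed limit function and at least one is a difference; Cauchy-Schwarz bounds each
  by a null sequence.\<close>

lemma tendsto_integral_mult_L2:
  assumes sq: "\<And>n. sq_integrable M (U n)" "\<And>n. sq_integrable M (V n)"
      "sq_integrable M U'" "sq_integrable M V'"
    and U: "(\<lambda>n. \<integral>x. (U' x - U n x)\<^sup>2 \<partial>M) \<longlonglongrightarrow> 0"
    and V: "(\<lambda>n. \<integral>x. (V' x - V n x)\<^sup>2 \<partial>M) \<longlonglongrightarrow> 0"
  shows "(\<lambda>n. \<integral>x. U n x * V n x \<partial>M) \<longlonglongrightarrow> (\<integral>x. U' x * V' x \<partial>M)"
proof -
  let ?A = "\<lambda>n. sqrt (\<integral>x. (U' x - U n x)\<^sup>2 \<partial>M)" and ?B = "\<lambda>n. sqrt (\<integral>x. (V' x - V n x)\<^sup>2 \<partial>M)"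
  let ?a = "sqrt (\<integral>x. (U' x)\<^sup>2 \<partial>M)" and ?b = "sqrt (\<integral>x. (V' x)\<^sup>2 \<partial>M)"
  have bound: "\<bar>(\<integral>x. U n x * V n x \<partial>M) - (\<integral>x. U' x * V' x \<partial>M)\<bar> \<le> ?A n * ?B n + ?A n * ?b + ?a * ?B n" for n
  proof -
    have d: "sq_integrable M (\<lambda>x. U' x - U n x)" "sq_integrable M (\<lambda>x. V' x - V n x)"
      by (intro sq_integrable_diff sq)+
    note int [simp] = integrable_mult_sq_integrable[OF d] integrable_mult_sq_integrable[OF d(1) sq(4)]
      integrable_mult_sq_integrable[OF sq(3) d(2)] integrable_mult_sq_integrable[OF sq(3,4)]
    have "(\<integral>x. U n x * V n x \<partial>M) = (\<integral>x. (U' x - U n x) * (V' x - V n x) - (U' x - U n x) * V' x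
        - U' x * (V' x - V n x) + U' x * V' x \<partial>M)"
      by (intro Bochner_Integration.integral_cong) (auto simp: algebra_simps)
    also have "\<dots> = (\<integral>x. (U' x - U n x) * (V' x - V n x) \<partial>M) - (\<integral>x. (U' x - U n x) * V' x \<partial>M)
        - (\<integral>x. U' x * (V' x - V n x) \<partial>M) + (\<integral>x. U' x * V' x \<partial>M)"
      by simp
    finally show ?thesis
      using Cauchy_Schwarz_integral[OF d] Cauchy_Schwarz_integral[OF d(1) sq(4)]
        Cauchy_Schwarz_integral[OF sq(3) d(2)] by linarith
  qed
  have A: "?A \<longlonglongrightarrow> sqrt 0" and B: "?B \<longlonglongrightarrow> sqrt 0"
    by (intro tendsto_real_sqrt U V)+
  have "(\<lambda>n. ?A n * ?B n + ?A n * ?b + ?a * ?B n) \<longlonglongrightarrow> sqrt 0 * sqrt 0 + sqrt 0 * ?b + ?a * sqrt 0"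
    by (intro tendsto_add tendsto_mult A B tendsto_const)
  then have "(\<lambda>n. ?A n * ?B n + ?A n * ?b + ?a * ?B n) \<longlonglongrightarrow> 0"
    by simp
  then have "(\<lambda>n. (\<integral>x. U n x * V n x \<partial>M) - (\<integral>x. U' x * V' x \<partial>M)) \<longlonglongrightarrow> 0"
    by (rule Lim_null_comparison[rotated]) (use bound in auto)
  then show ?thesis
    by (rule LIM_zero_cancel)
qed

lemma (in prob_space) tendsto_covariance_L2:
  assumes sq: "\<And>n. sq_integrable M (U n)" "\<And>n. sq_integrable M (V n)"
      "sq_integrable M U'" "sq_integrable M V'"
    and U: "(\<lambda>n. \<integral>x. (U' x - U n x)\<^sup>2 \<partial>M) \<longlonglongrightarrow> 0"
    and V: "(\<lambda>n. \<integral>x. (V' x - V n x)\<^sup>2 \<partial>M) \<longlonglongrightarrow> 0"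
  shows "(\<lambda>n. covariance M (U n) (V n)) \<longlonglongrightarrow> covariance M U' V'"
proof -
  \<comment> \<open>Convergence of means is convergence of products with the constant 1.\<close>
  have "(\<lambda>n. expectation (W n)) \<longlonglongrightarrow> expectation W'"
    if "\<And>n. sq_integrable M (W n)" "sq_integrable M W'"
      "(\<lambda>n. \<integral>x. (W' x - W n x)\<^sup>2 \<partial>M) \<longlonglongrightarrow> 0" for W W'
    using tendsto_integral_mult_L2[OF that(1) sq_integrable_const[of 1] that(2) sq_integrable_const[of 1] that(3)]
    by simp
  from this[OF sq(1,3) U] this[OF sq(2,4) V] show ?thesis
    unfolding covariance_eq[OF sq(1,2)] covariance_eq[OF sq(3,4)]
    by (intro tendsto_diff tendsto_mult tendsto_integral_mult_L2[OF assms])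
qed

section \<open>Cylinder functions on the path space\<close>

text \<open>Initial segments take the place of arbitrary finite index sets: they are nested, so two
  cylinder functions have a common level, and they are the index sets of the finite walks.\<close>

definition cylinder_functions :: "nat \<Rightarrow> ((nat \<Rightarrow> real) \<Rightarrow> real) set" where
  "cylinder_functions n = {h. \<exists>g\<in>borel_measurable (path_space {0..n}). \<forall>x. h x = g (restrict x {0..n})}"

lemma cylinder_functions_mono:
  assumes "n \<le> m"
  shows "cylinder_functions n \<subseteq> cylinder_functions m"
proof
  fix h assume "h \<in> cylinder_functions n"
  then obtain g where g: "g \<in> borel_measurable (path_space {0..n})" "\<And>x. h x = g (restrict x {0..n})"
    by (auto simp: cylinder_functions_def)
  have "(\<lambda>x. g (restrict x {0..n})) \<in> borel_measurable (path_space {0..m})"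
    using assms by (intro measurable_compose[OF measurable_restrict_subset g(1)]) auto
  moreover have "h x = g (restrict (restrict x {0..m}) {0..n})" for x
    using assms by (simp add: g(2) Int_absorb1)
  ultimately show "h \<in> cylinder_functions m"
    unfolding cylinder_functions_def by (intro CollectI bexI[of _ "\<lambda>x. g (restrict x {0..n})"]) auto
qed

lemma measurable_cylinder_functions: "h \<in> cylinder_functions n \<Longrightarrow> h \<in> borel_measurable (path_space UNIV)"
proof -
  assume "h \<in> cylinder_functions n"
  then obtain g where g: "g \<in> borel_measurable (path_space {0..n})" "h = (\<lambda>x. g (restrict x {0..n}))"
    by (auto simp: cylinder_functions_def fun_eq_iff)
  show ?thesis
    unfolding g(2) by (intro measurable_compose[OF measurable_restrict_subset g(1)]) auto
qed

lemma cylinder_functions_lincomb: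
  assumes "h \<in> cylinder_functions n" "k \<in> cylinder_functions n"
  shows "(\<lambda>x. a * h x + k x) \<in> cylinder_functions n"
proof -
  from assms obtain g l where "g \<in> borel_measurable (path_space {0..n})" "\<And>x. h x = g (restrict x {0..n})"
    "l \<in> borel_measurable (path_space {0..n})" "\<And>x. k x = l (restrict x {0..n})"
    by (auto simp: cylinder_functions_def)
  then show ?thesis
    unfolding cylinder_functions_def by (intro CollectI bexI[of _ "\<lambda>x. a * g x + l x"]) auto
qed

text \<open>A generator of the product sigma-algebra constrains the coordinates in a finite set
  \<open>J\<close> only, and \<open>J\<close> lies below some \<open>n\<close>.\<close>

lemma indicator_prod_algebra_cylinder:
  assumes "A \<in> prod_algebra UNIV (\<lambda>_. borel :: real measure)"
  shows "\<exists>n. (indicator A :: (nat \<Rightarrow> real) \<Rightarrow> real) \<in> cylinder_functions n"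
proof -
  from assms obtain J E where A: "A = prod_emb UNIV (\<lambda>_. borel) J (\<Pi>\<^sub>E j\<in>J. E j)"
    and J: "finite J" and E: "\<And>j. j \<in> J \<Longrightarrow> E j \<in> sets borel"
    by (auto elim!: prod_algebraE)
  from J obtain n where "\<forall>j\<in>J. j \<le> n"
    by (auto simp: finite_nat_set_iff_bounded_le)
  then have n: "J \<subseteq> {0..n}"
    by auto
  let ?B = "{x \<in> space (path_space {0..n}). \<forall>j\<in>J. x j \<in> E j}"
  have "?B \<in> sets (path_space {0..n})"
    using J n E by measurable (use n in auto)
  moreover have "indicator A x = (indicator ?B (restrict x {0..n}) :: real)" for x
    using n by (auto simp: A prod_emb_def space_PiM PiE_iff subset_iff split: split_indicator)
  ultimately show ?thesis
    unfolding cylinder_functions_def by (intro exI[of _ n] CollectI bexI[of _ "indicator ?B"]) auto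
qed

text \<open>Product structure is asked of the sigma-algebra, not of \<open>N\<close>: in the
  application \<open>N\<close> is the law of a walk, whose coordinates are in general
  dependent.\<close>

lemma L2_approx_cylinder:
  assumes "finite_measure N" and N: "sets N = sets (path_space UNIV)" and f: "sq_integrable N f"
  obtains h n where "\<And>k::nat. h k \<in> cylinder_functions (n k)" "\<And>k. sq_integrable N (h k)"
    "(\<lambda>k. \<integral>x. (f x - h k x)\<^sup>2 \<partial>N) \<longlonglongrightarrow> 0"
proof -
  interpret finite_measure N by fact
  \<comment> \<open>All levels together, so that the generator is covered; square-integrability is
    added since cylinder functions may lack it.\<close>
  let ?C = "{h. sq_integrable N h \<and> (\<exists>n. h \<in> cylinder_functions n)}"
  have "f \<in> L2_closure N ?C"
  proof (rule L2_closure_generator[OF Int_stable_prod_algebra])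
    show "prod_algebra UNIV (\<lambda>_. borel) \<subseteq> Pow (space N)"
      using prod_algebra_sets_into_space[of UNIV "\<lambda>_. borel :: real measure"] sets_eq_imp_space_eq[OF N]
      by (simp add: space_PiM)
    show "sets N = sigma_sets (space N) (prod_algebra UNIV (\<lambda>_. borel))"
      unfolding N sets_PiM sets_eq_imp_space_eq[OF N] by (simp add: space_PiM)
    show "(\<lambda>x. a * h x + k x) \<in> ?C" if hk: "h \<in> ?C" "k \<in> ?C" for a h k
    proof -
      obtain n m where "h \<in> cylinder_functions n" "k \<in> cylinder_functions m"
        using hk by blast
      then have "h \<in> cylinder_functions (max n m)" "k \<in> cylinder_functions (max n m)"
        using cylinder_functions_mono[of n "max n m"] cylinder_functions_mono[of m "max n m"] by auto
      then have "(\<lambda>x. a * h x + k x) \<in> cylinder_functions (max n m)"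
        by (rule cylinder_functions_lincomb)
      with hk show ?thesis
        by (auto intro: sq_integrable_add sq_integrable_cmult)
    qed
    show "(\<lambda>_. 1) \<in> ?C"
      by (auto simp: cylinder_functions_def sq_integrable_const intro!: bexI[of _ "\<lambda>_. 1"])
    show "indicator A \<in> ?C" if A: "A \<in> prod_algebra UNIV (\<lambda>_. borel)" for A
    proof -
      obtain n where n: "(indicator A :: (nat \<Rightarrow> real) \<Rightarrow> real) \<in> cylinder_functions n"
        using indicator_prod_algebra_cylinder[OF A] by blast
      have "(indicator A :: (nat \<Rightarrow> real) \<Rightarrow> real) \<in> borel_measurable N"
        using measurable_cylinder_functions[OF n] unfolding measurable_cong_sets[OF N refl] .
      then have "sq_integrable N (indicator A)"
        by (rule sq_integrable_bound[OF sq_integrable_const[of 1]]) (auto split: split_indicator)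
      with n show ?thesis by blast
    qed
  qed (use f in auto)
  then have "\<exists>h. h \<in> ?C \<and> (\<integral>x. (f x - h x)\<^sup>2 \<partial>N) < 1 / real (Suc k)" for k
    unfolding L2_closure_def Bex_def by simp
  then have "\<forall>k. \<exists>h. h \<in> ?C \<and> (\<integral>x. (f x - h x)\<^sup>2 \<partial>N) < 1 / real (Suc k)"
    by (rule allI)
  from choice[OF this] obtain h
    where h: "\<And>k. h k \<in> ?C" "\<And>k. (\<integral>x. (f x - h k x)\<^sup>2 \<partial>N) < 1 / real (Suc k)"
    by (elim exE) blast
  from h(1) have "\<forall>k. \<exists>n. h k \<in> cylinder_functions n"
    by blast
  from choice[OF this] obtain n where n: "\<And>k. h k \<in> cylinder_functions (n k)"
    by (elim exE) blast
  have "(\<lambda>k. \<integral>x. (f x - h k x)\<^sup>2 \<partial>N) \<longlonglongrightarrow> 0"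
  proof (rule tendsto_sandwich[OF _ _ tendsto_const LIMSEQ_inverse_real_of_nat])
    show "\<forall>\<^sub>F k in sequentially. (\<integral>x. (f x - h k x)\<^sup>2 \<partial>N) \<le> inverse (real (Suc k))"
      using h(2) by (intro always_eventually allI) (simp add: less_imp_le inverse_eq_divide)
  qed simp
  with n h(1) show ?thesis
    by (intro that) auto
qed

lemma (in prob_space) covariance_bounded_path_space_UNIV:
  assumes X[measurable]: "X \<in> measurable M (path_space UNIV)"
    and Y[measurable]: "Y \<in> measurable M (path_space UNIV)"
    and b: "\<And>n. covariance_bounded r M (path_space {0..n}) (\<lambda>\<omega>. restrict (X \<omega>) {0..n})
                   (path_space {0..n}) (\<lambda>\<omega>. restrict (Y \<omega>) {0..n})"
  shows "covariance_bounded r M (path_space UNIV) X (path_space UNIV) Y"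
  unfolding covariance_bounded_def
proof (intro ballI impI)
  fix \<phi> \<psi> :: "(nat \<Rightarrow> real) \<Rightarrow> real"
  assume [measurable]: "\<phi> \<in> borel_measurable (path_space UNIV)" "\<psi> \<in> borel_measurable (path_space UNIV)"
    and sq: "sq_integrable M (\<lambda>\<omega>. \<phi> (X \<omega>))" "sq_integrable M (\<lambda>\<omega>. \<psi> (Y \<omega>))"
  \<comment> \<open>Approximation takes place under the law of \<open>Z\<close> and is pulled back
    along \<open>Z\<close>, so the approximants remain functions of \<open>Z\<close> alone.\<close>
  have approx: "\<exists>h n. (\<forall>k::nat. h k \<in> cylinder_functions (n k) \<and> sq_integrable M (\<lambda>\<omega>. h k (Z \<omega>))) \<and>
      (\<lambda>k. expectation (\<lambda>\<omega>. (f (Z \<omega>) - h k (Z \<omega>))\<^sup>2)) \<longlonglongrightarrow> 0"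
    if [measurable]: "Z \<in> measurable M (path_space UNIV)" "f \<in> borel_measurable (path_space UNIV)"
      and f: "sq_integrable M (\<lambda>\<omega>. f (Z \<omega>))" for Z f
  proof -
    let ?N = "distr M (path_space UNIV) Z"
    interpret D: prob_space ?N
      by (rule prob_space_distr) measurable
    have f': "sq_integrable ?N f"
      using f by (simp add: sq_integrable_def integrable_distr_eq)
    obtain h n where h: "\<And>k::nat. h k \<in> cylinder_functions (n k)" "\<And>k. sq_integrable ?N (h k)"
      "(\<lambda>k. \<integral>x. (f x - h k x)\<^sup>2 \<partial>?N) \<longlonglongrightarrow> 0"
      using L2_approx_cylinder[OF D.finite_measure_axioms sets_distr f'] by blast
    have [measurable]: "h k \<in> borel_measurable (path_space UNIV)" for k
      using h(1) by (rule measurable_cylinder_functions)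
    have "sq_integrable M (\<lambda>\<omega>. h k (Z \<omega>))" for k
      using h(2)[of k] by (simp add: sq_integrable_def integrable_distr_eq)
    with h(1,3) show ?thesis
      by (intro exI[of _ h] exI[of _ n]) (simp add: integral_distr)
  qed
  obtain h n where h: "\<And>k::nat. h k \<in> cylinder_functions (n k)" "\<And>k. sq_integrable M (\<lambda>\<omega>. h k (X \<omega>))"
      "(\<lambda>k. expectation (\<lambda>\<omega>. (\<phi> (X \<omega>) - h k (X \<omega>))\<^sup>2)) \<longlonglongrightarrow> 0"
    using approx[OF X _ sq(1)] by auto
  obtain g m where g: "\<And>k::nat. g k \<in> cylinder_functions (m k)" "\<And>k. sq_integrable M (\<lambda>\<omega>. g k (Y \<omega>))"
      "(\<lambda>k. expectation (\<lambda>\<omega>. (\<psi> (Y \<omega>) - g k (Y \<omega>))\<^sup>2)) \<longlonglongrightarrow> 0"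
    using approx[OF Y _ sq(2)] by auto
  have le: "covariance M (\<lambda>\<omega>. h k (X \<omega>)) (\<lambda>\<omega>. g k (Y \<omega>))
     \<le> r * sqrt (covariance M (\<lambda>\<omega>. h k (X \<omega>)) (\<lambda>\<omega>. h k (X \<omega>))
               * covariance M (\<lambda>\<omega>. g k (Y \<omega>)) (\<lambda>\<omega>. g k (Y \<omega>)))" for k
  proof -
    \<comment> \<open>The two approximants may have different levels; \<open>b\<close> is applied at
      the larger one.\<close>
    let ?n = "max (n k) (m k)"
    have "h k \<in> cylinder_functions ?n" "g k \<in> cylinder_functions ?n"
      using h(1)[of k] g(1)[of k] cylinder_functions_mono[of "n k" ?n] cylinder_functions_mono[of "m k" ?n]
      by auto
    then obtain h' g' where m: "h' \<in> borel_measurable (path_space {0..?n})" "g' \<in> borel_measurable (path_space {0..?n})"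
      and eq: "h k = (\<lambda>x. h' (restrict x {0..?n}))" "g k = (\<lambda>x. g' (restrict x {0..?n}))"
      by (auto simp: cylinder_functions_def fun_eq_iff)
    show ?thesis
      using h(2)[of k] g(2)[of k] unfolding eq by (rule covariance_boundedD[OF b m])
  qed
  note lim = tendsto_covariance_L2[OF h(2) g(2) sq h(3) g(3)]
    tendsto_covariance_L2[OF h(2) h(2) sq(1) sq(1) h(3) h(3)]
    tendsto_covariance_L2[OF g(2) g(2) sq(2) sq(2) g(3) g(3)]
  show "covariance M (\<lambda>\<omega>. \<phi> (X \<omega>)) (\<lambda>\<omega>. \<psi> (Y \<omega>))
     \<le> r * sqrt (covariance M (\<lambda>\<omega>. \<phi> (X \<omega>)) (\<lambda>\<omega>. \<phi> (X \<omega>))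
               * covariance M (\<lambda>\<omega>. \<psi> (Y \<omega>)) (\<lambda>\<omega>. \<psi> (Y \<omega>)))"
    by (rule LIMSEQ_le[OF lim(1) tendsto_mult[OF tendsto_const tendsto_real_sqrt[OF tendsto_mult[OF lim(2,3)]]]])
      (use le in blast)
qed

section \<open>Random walks\<close>

lemma walk_measurable:
  assumes "\<And>k. k \<ge> 1 \<Longrightarrow> \<zeta> k \<in> borel_measurable M"
  shows "walk I \<zeta> \<in> measurable M (path_space I)"
  unfolding walk_def partial_sum_def
  using assms by (intro measurable_restrict borel_measurable_sum) auto

lemma restrict_walk: "J \<subseteq> I \<Longrightarrow> restrict (walk I \<zeta> \<omega>) J = walk J \<zeta> \<omega>"
  by (auto simp: walk_def restrict_def fun_eq_iff)

text \<open>The longer walk is one fixed map of the shorter walk and the new step. The same map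
  serves \<open>\<xi>\<close> and \<open>\<eta>\<close>, and the induction composes with it.\<close>

lemma walk_Suc:
  "walk {0..Suc n} \<zeta> \<omega>
     = (\<lambda>k\<in>{0..Suc n}. if k \<le> n then walk {0..n} \<zeta> \<omega> k else walk {0..n} \<zeta> \<omega> n + \<zeta> (Suc n) \<omega>)"
  by (auto simp: walk_def partial_sum_def fun_eq_iff le_Suc_eq)

text \<open>The variance on the constant side is 0, and Cauchy-Schwarz then makes the covariance at
  most 0. This starts the induction, where the walk consists of its value 0 at time 0.\<close>

lemma (in prob_space) covariance_bounded_const:
  assumes "\<And>\<omega>. X \<omega> = c"
  shows "covariance_bounded r M K X L Y"
  unfolding covariance_bounded_def
proof (intro ballI impI)
  fix \<phi> \<psi> assume "sq_integrable M (\<lambda>\<omega>. \<phi> (X \<omega>))" "sq_integrable M (\<lambda>\<omega>. \<psi> (Y \<omega>))"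
  note CS = covariance_Cauchy_Schwarz[OF this]
  have zero: "covariance M (\<lambda>\<omega>. \<phi> (X \<omega>)) (\<lambda>\<omega>. \<phi> (X \<omega>)) = 0"
    by (rule covariance_self_AE_const[of _ "\<phi> c"]) (simp_all add: assms)
  then show "covariance M (\<lambda>\<omega>. \<phi> (X \<omega>)) (\<lambda>\<omega>. \<psi> (Y \<omega>))
     \<le> r * sqrt (covariance M (\<lambda>\<omega>. \<phi> (X \<omega>)) (\<lambda>\<omega>. \<phi> (X \<omega>))
               * covariance M (\<lambda>\<omega>. \<psi> (Y \<omega>)) (\<lambda>\<omega>. \<psi> (Y \<omega>)))"
    using CS unfolding zero by simp
qed

lemma covariance_bounded_identically_distributed:
  fixes X Y :: "'a \<Rightarrow> real"
  assumes [measurable]: "X \<in> borel_measurable M" "Y \<in> borel_measurable M"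
      "X' \<in> borel_measurable M" "Y' \<in> borel_measurable M"
    and eq: "distr M borel (\<lambda>\<omega>. (X \<omega>, Y \<omega>)) = distr M borel (\<lambda>\<omega>. (X' \<omega>, Y' \<omega>))"
    and b: "covariance_bounded r M borel X' borel Y'"
  shows "covariance_bounded r M borel X borel Y"
  using b eq covariance_bounded_distr[of X M borel Y borel r] covariance_bounded_distr[of X' M borel Y' borel r]
  by (simp add: borel_prod)

context prob_space
begin

context
  fixes \<xi> \<eta> :: "nat \<Rightarrow> 'a \<Rightarrow> real"
  assumes indep: "indep_vars (\<lambda>_. borel :: (real \<times> real) measure) (\<lambda>n \<omega>. (\<xi> n \<omega>, \<eta> n \<omega>)) {1..}"
begin

lemma steps_measurable:
  assumes "n \<ge> 1"
  shows "\<xi> n \<in> borel_measurable M" "\<eta> n \<in> borel_measurable M"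
proof -
  have "(\<lambda>\<omega>. (\<xi> n \<omega>, \<eta> n \<omega>)) \<in> measurable M (borel \<Otimes>\<^sub>M borel)"
    using indep assms by (auto simp: indep_vars_def borel_prod)
  then show "\<xi> n \<in> borel_measurable M" "\<eta> n \<in> borel_measurable M"
    by (simp_all add: measurable_pair_iff comp_def)
qed

lemma covariance_bounded_walk:
  assumes "r \<ge> 0" and step: "\<And>n. n \<ge> 1 \<Longrightarrow> covariance_bounded r M borel (\<xi> n) borel (\<eta> n)"
  shows "covariance_bounded r M (path_space {0..n}) (walk {0..n} \<xi>) (path_space {0..n}) (walk {0..n} \<eta>)"
proof (induction n)
  case 0
  show ?case
    by (rule covariance_bounded_const[of _ "\<lambda>k\<in>{0}. 0"]) (simp add: walk_def partial_sum_def fun_eq_iff)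
next
  case (Suc n)
  let ?B = "\<lambda>_::nat. borel :: (real \<times> real) measure"
  \<comment> \<open>Past steps and new step are restrictions of one independent family to disjoint
    index sets, which makes them independent and gives them a common type.\<close>
  let ?Z = "\<lambda>\<omega>. restrict (\<lambda>i. (\<xi> i \<omega>, \<eta> i \<omega>)) {1..n}"
  let ?W = "\<lambda>\<omega>. restrict (\<lambda>i. (\<xi> i \<omega>, \<eta> i \<omega>)) {Suc n}"
  \<comment> \<open>Rebuilds the walk of one component, \<open>f\<close> being \<open>fst\<close> or
    \<open>snd\<close>, from the block of steps. For k \<le> n the sum uses indices in {1..n} only,
    so the value \<open>undefined\<close> outside the block never enters.\<close>
  let ?w = "\<lambda>f z. \<lambda>k\<in>{0..n}. \<Sum>i=1..k. f (z i :: real \<times> real) :: real"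
  let ?h = "\<lambda>(x, t). \<lambda>k\<in>{0..Suc n}. if k \<le> n then x k else x n + t :: real"
  have ind: "indep_var (Pi\<^sub>M {1..n} ?B) ?Z (Pi\<^sub>M {Suc n} ?B) ?W"
    by (rule indep_var_restrict[OF indep]) auto
  have [measurable]: "(fst :: real \<times> real \<Rightarrow> real) \<in> borel_measurable borel"
    "(snd :: real \<times> real \<Rightarrow> real) \<in> borel_measurable borel"
    by (intro borel_measurable_continuous_onI continuous_intros)+
  have w: "?w f \<in> measurable (Pi\<^sub>M {1..n} ?B) (path_space {0..n})"
    if f: "f \<in> borel_measurable borel" for f
  proof (intro measurable_restrict borel_measurable_sum)
    fix k i assume "k \<in> {0..n}" "i \<in> {1..k}"
    then have i: "i \<in> {1..n}" by auto
    show "(\<lambda>z. f (z i)) \<in> borel_measurable (Pi\<^sub>M {1..n} ?B)"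
      by (rule measurable_compose[OF measurable_component_singleton[OF i] f])
  qed
  have h: "?h \<in> measurable (path_space {0..n} \<Otimes>\<^sub>M borel) (path_space {0..Suc n})"
    unfolding split_beta'
  proof (rule measurable_restrict)
    have coord: "(\<lambda>x. fst x k) \<in> borel_measurable (path_space {0..n} \<Otimes>\<^sub>M (borel :: real measure))"
      if "k \<le> n" for k
      using that by (intro measurable_compose[OF measurable_fst measurable_component_singleton]) simp
    fix k
    show "(\<lambda>x. if k \<le> n then fst x k else fst x n + snd x) \<in> borel_measurable (path_space {0..n} \<Otimes>\<^sub>M borel)"
    proof (cases "k \<le> n")
      case True
      with coord[of k] show ?thesis by simp
    next
      case False
      with borel_measurable_add[OF coord[of n] measurable_snd] show ?thesis by simp
    qed
  qed
  have Z: "?w fst (?Z \<omega>) = walk {0..n} \<xi> \<omega>" "?w snd (?Z \<omega>) = walk {0..n} \<eta> \<omega>" for \<omega>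
    by (auto simp: walk_def partial_sum_def fun_eq_iff intro!: sum.cong)
  have "covariance_bounded r M
      (path_space {0..n} \<Otimes>\<^sub>M borel) (\<lambda>\<omega>. (?w fst (?Z \<omega>), (\<lambda>w. fst (w (Suc n))) (?W \<omega>)))
      (path_space {0..n} \<Otimes>\<^sub>M borel) (\<lambda>\<omega>. (?w snd (?Z \<omega>), (\<lambda>w. snd (w (Suc n))) (?W \<omega>)))"
  proof (rule covariance_bounded_indep_var[OF \<open>r \<ge> 0\<close> ind])
    show "covariance_bounded r M (path_space {0..n}) (\<lambda>\<omega>. ?w fst (?Z \<omega>))
        (path_space {0..n}) (\<lambda>\<omega>. ?w snd (?Z \<omega>))"
      unfolding Z by (rule Suc.IH)
    show "covariance_bounded r M borel (\<lambda>\<omega>. fst (?W \<omega> (Suc n))) borel (\<lambda>\<omega>. snd (?W \<omega> (Suc n)))"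
      using step[of "Suc n"] by simp
  qed (use w in measurable)
  then have "covariance_bounded r M
      (path_space {0..n} \<Otimes>\<^sub>M borel) (\<lambda>\<omega>. (walk {0..n} \<xi> \<omega>, \<xi> (Suc n) \<omega>))
      (path_space {0..n} \<Otimes>\<^sub>M borel) (\<lambda>\<omega>. (walk {0..n} \<eta> \<omega>, \<eta> (Suc n) \<omega>))"
    unfolding Z by simp
  from covariance_bounded_compose[OF this h h] show ?case
    unfolding walk_Suc[abs_def] case_prod_conv .
qed

lemma covariance_bounded_walk_UNIV:
  assumes "r \<ge> 0" and "\<And>n. n \<ge> 1 \<Longrightarrow> covariance_bounded r M borel (\<xi> n) borel (\<eta> n)"
  shows "covariance_bounded r M (path_space UNIV) (walk UNIV \<xi>) (path_space UNIV) (walk UNIV \<eta>)"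
proof (rule covariance_bounded_path_space_UNIV)
  show "covariance_bounded r M (path_space {0..n}) (\<lambda>\<omega>. restrict (walk UNIV \<xi> \<omega>) {0..n})
          (path_space {0..n}) (\<lambda>\<omega>. restrict (walk UNIV \<eta> \<omega>) {0..n})" for n
    using covariance_bounded_walk[OF assms] by (simp add: restrict_walk)
qed (intro walk_measurable steps_measurable; assumption)+

end

end

text \<open>Coordinate 1 of the walk is the sum of a single step. The condition on \<open>I\<close>
  is where m \<ge> 1 enters: for m = 0 the walk is constant and its maximal correlation is
  0.\<close>

lemma covariance_bounded_first_step:
  assumes "1 \<in> I"
    and b: "covariance_bounded r M (path_space I) (walk I \<xi>) (path_space I) (walk I \<eta>)"
  shows "covariance_bounded r M borel (\<xi> 1) borel (\<eta> 1)"
proof -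
  have "(\<lambda>x. x 1) \<in> measurable (path_space I) borel"
    using assms(1) by (rule measurable_component_singleton)
  from covariance_bounded_compose[OF b this this] show ?thesis
    using assms(1) by (simp add: walk_def partial_sum_def)
qed

theorem theorem1p1:
  fixes M :: "'a measure"
    and \<xi> \<eta> :: "nat \<Rightarrow> 'a \<Rightarrow> real"
    and m :: nat
  assumes "prob_space M"
    and "prob_space.indep_vars M (\<lambda>_. borel :: (real \<times> real) measure)
           (\<lambda>n \<omega>. (\<xi> n \<omega>, \<eta> n \<omega>)) {1..}"
    and "\<forall>n\<ge>1. distr M borel (\<lambda>\<omega>. (\<xi> n \<omega>, \<eta> n \<omega>)) = distr M borel (\<lambda>\<omega>. (\<xi> 1 \<omega>, \<eta> 1 \<omega>))"
    and "m \<ge> 1"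
  shows "maximal_correlation M (path_space {0..m}) (walk {0..m} \<xi>) (path_space {0..m}) (walk {0..m} \<eta>)
           = maximal_correlation M borel (\<xi> 1) borel (\<eta> 1)
       \<and> maximal_correlation M borel (\<xi> 1) borel (\<eta> 1)
           = maximal_correlation M (path_space UNIV) (walk UNIV \<xi>) (path_space UNIV) (walk UNIV \<eta>)"
proof -
  interpret prob_space M by fact
  note meas = steps_measurable[OF assms(2)]
  have walk_meas: "walk I \<xi> \<in> measurable M (path_space I)" "walk I \<eta> \<in> measurable M (path_space I)" for I
    by (rule walk_measurable, erule meas)+
  have meas_1: "\<xi> 1 \<in> borel_measurable M" "\<eta> 1 \<in> borel_measurable M"
    by (rule meas, simp)+
  \<comment> \<open>Identical distribution enters here: a bound for the first pair is a bound, with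
    the same \<open>r\<close>, for the pair at every step.\<close>
  have step: "covariance_bounded r M borel (\<xi> n) borel (\<eta> n)"
    if "covariance_bounded r M borel (\<xi> 1) borel (\<eta> 1)" "n \<ge> 1" for r n
    using meas[OF that(2)] meas_1 assms(3)[rule_format, OF that(2)] that(1)
    by (rule covariance_bounded_identically_distributed)
  show ?thesis
  proof
    show "maximal_correlation M (path_space {0..m}) (walk {0..m} \<xi>) (path_space {0..m}) (walk {0..m} \<eta>)
           = maximal_correlation M borel (\<xi> 1) borel (\<eta> 1)"
    proof (rule maximal_correlation_eqI[OF assms(1) walk_meas meas_1], rule iffI)
      fix r :: real assume "r \<ge> 0"
      show "covariance_bounded r M borel (\<xi> 1) borel (\<eta> 1)"
        if "covariance_bounded r M (path_space {0..m}) (walk {0..m} \<xi>) (path_space {0..m}) (walk {0..m} \<eta>)"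
        using assms(4) that by (intro covariance_bounded_first_step[of "{0..m}"]) auto
      show "covariance_bounded r M (path_space {0..m}) (walk {0..m} \<xi>) (path_space {0..m}) (walk {0..m} \<eta>)"
        if "covariance_bounded r M borel (\<xi> 1) borel (\<eta> 1)"
        by (rule covariance_bounded_walk[OF assms(2) \<open>r \<ge> 0\<close> step[OF that]])
    qed
    show "maximal_correlation M borel (\<xi> 1) borel (\<eta> 1)
           = maximal_correlation M (path_space UNIV) (walk UNIV \<xi>) (path_space UNIV) (walk UNIV \<eta>)"
    proof (rule maximal_correlation_eqI[OF assms(1) meas_1 walk_meas], rule iffI)
      fix r :: real assume "r \<ge> 0"
      show "covariance_bounded r M borel (\<xi> 1) borel (\<eta> 1)"
        if "covariance_bounded r M (path_space UNIV) (walk UNIV \<xi>) (path_space UNIV) (walk UNIV \<eta>)"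
        by (rule covariance_bounded_first_step[OF UNIV_I that])
      show "covariance_bounded r M (path_space UNIV) (walk UNIV \<xi>) (path_space UNIV) (walk UNIV \<eta>)"
        if "covariance_bounded r M borel (\<xi> 1) borel (\<eta> 1)"
        by (rule covariance_bounded_walk_UNIV[OF assms(2) \<open>r \<ge> 0\<close> step[OF that]])
    qed
  qed
qed

end
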